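(* Let $\varphi$ be a gauge, let $(X,\|\cdot\|_X)$ be a reflexive, strictly convex, and Gateaux differentiable real Banach space, and let $\varnothing\ne K\subseteq X$. Then: (i) if $K$ is convex and closed, then $K$ is left $D_{\Psi_\varphi}$-Chebyshev, and $D_{\Psi_\varphi}$ is left pythagorean on $K$; (ii) if $j_\varphi(K)$ is convex and closed, then $K$ is right $D_{\Psi_\varphi}$-Chebyshev, and $D_{\Psi_\varphi}$ is right pythagorean on $K$; (iii) $D_{\Psi_\varphi}$ is an information on $X$, and $D_{\Psi_\varphi^*}$ is an information on $X^*$; (iv) the left projections (for $K$ as in (i)) and the right projections (for $K$ as in (ii)) are zone consistent.
   Context: A gauge is a strictly increasing continuous $\varphi:[0,\infty[\to[0,\infty[$ with $\varphi(0)=0$, $\lim_{t\to\infty}\varphi(t)=\infty$. $\Psi_\varphi(x)=\int_0^{\|x\|}\varphi(t)\,dt$ on $X$; $\Psi_\varphi^*$ is its convex conjugate on $X^*$; both are finite everywhere. $(X,\|\cdot\|)$ is Gateaux differentiable iff its norm is Gateaux differentiable at all $x\ne0$. The duality map $j_\varphi(x)=\{y\in X^*:\langle x,y\rangle=\|x\|\|y\|,\ \|y\|=\varphi(\|x\|)\}$ is then single-valued and equals the Gateaux derivative $D\Psi_\varphi$; $\langle\cdot,\cdot\rangle$ is the pairing of $X\times X^*$. For a finite convex Gateaux differentiable $\Psi$: $D_\Psi(x,y)=\Psi(x)-\Psi(y)-\langle x-y,D\Psi(y)\rangle$. $D_\Psi$ is an information on a set $Z$ iff $D_\Psi(x,y)=0\iff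 x=y$ for all $x,y\in Z$. $K$ is left (resp. right) $D_\Psi$-Chebyshev iff for each $y\in X$ the function $x\mapsto D_\Psi(x,y)$ (resp. $x\mapsto D_\Psi(y,x)$) has a unique minimiser over $K$, denoted $\overleftarrow{P}_K(y)$ (resp. $\overrightarrow{P}_K(y)$). The projection is zone consistent iff it maps $\mathrm{int\,dom}\,\Psi$ into $\mathrm{int\,dom}\,\Psi$, where $\mathrm{dom}\,\Psi=\{x:\Psi(x)\neq\infty\}$. $D_\Psi$ is left pythagorean on $K$ iff $K$ is left $D_\Psi$-Chebyshev and for all $x\in\mathrm{int\,dom}\,\Psi$, $w\in K$, the following are equivalent: (1) $w=\overleftarrow{P}_K(x)$; (2) $w$ is the unique $z\in K$ with $\langle z-y,D\Psi(x)-D\Psi(z)\rangle\ge0$ for all $y\in K$; (3) $w$ is the unique $z\in K$ with $D_\Psi(y,z)+D_\Psi(z,x)\le D_\Psi(y,x)$ for all $y\in K$. $D_\Psi$ is right pythagorean on $K$ iff $K$ is right $D_\Psi$-Chebyshev and for all $x\in\mathrm{int\,dom}\,\Psi$, $w\in K$, the following are equivalent: (1) $w=\overrightarrow{P}_K(x)$; (2) $w$ is the unique $z\in K$ with $\langle x-z,D\Psi(z)-D\Psi(y)\rangle\ge0$ for all $y\in K$; (3) $w$ is the unique $z\in K$ with $D_\Psi(x,z)+D_\Psi(z,y)\le D_\Psi(x,y)$ for all $y\in K$. *)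

theory Defs
  imports "HOL-Analysis.Analysis"
begin

text \<open>The topological dual of \<open>'a\<close> is \<open>'a \<Rightarrow>\<^sub>L real\<close> with the operator norm, and the pairing
  \<open>\<langle>x, y\<rangle>\<close> is \<open>blinfun_apply y x\<close>. Convex functions take values in the extended reals.\<close>

definition gauge_function :: "(real \<Rightarrow> real) \<Rightarrow> bool" where
  "gauge_function \<phi> \<longleftrightarrow>
     strict_mono_on {0..} \<phi> \<and> continuous_on {0..} \<phi> \<and> \<phi> 0 = 0 \<and> filterlim \<phi> at_top at_top"

definition effective_domain :: "('a \<Rightarrow> ereal) \<Rightarrow> 'a set" where
  "effective_domain \<Psi> = {x. \<Psi> x \<noteq> \<infinity>}"

definition has_gateaux_derivative ::
    "('a::real_normed_vector \<Rightarrow> ereal) \<Rightarrow> ('a \<Rightarrow>\<^sub>L real) \<Rightarrow> 'a \<Rightarrow> bool" where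
  "has_gateaux_derivative \<Psi> \<Psi>' x \<longleftrightarrow>
     \<bar>\<Psi> x\<bar> \<noteq> \<infinity> \<and>
     (\<forall>h. ((\<lambda>t::real. (\<Psi> (x + t *\<^sub>R h) - \<Psi> x) / ereal t)
            \<longlongrightarrow> ereal (blinfun_apply \<Psi>' h)) (at 0))"

definition gateaux_differentiable_at :: "('a::real_normed_vector \<Rightarrow> ereal) \<Rightarrow> 'a \<Rightarrow> bool" where
  "gateaux_differentiable_at \<Psi> x \<longleftrightarrow> (\<exists>\<Psi>'. has_gateaux_derivative \<Psi> \<Psi>' x)"

definition gateaux_deriv :: "('a::real_normed_vector \<Rightarrow> ereal) \<Rightarrow> 'a \<Rightarrow> ('a \<Rightarrow>\<^sub>L real)" where
  "gateaux_deriv \<Psi> x = (THE \<Psi>'. has_gateaux_derivative \<Psi> \<Psi>' x)"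

definition reflexive_space :: "'a::real_normed_vector itself \<Rightarrow> bool" where
  "reflexive_space _ \<longleftrightarrow>
     (\<forall>F :: ('a \<Rightarrow>\<^sub>L real) \<Rightarrow>\<^sub>L real. \<exists>x::'a. \<forall>y. blinfun_apply F y = blinfun_apply y x)"

definition strictly_convex_space :: "'a::real_normed_vector itself \<Rightarrow> bool" where
  "strictly_convex_space _ \<longleftrightarrow>
     (\<forall>x y::'a. \<forall>t. norm x = 1 \<longrightarrow> norm y = 1 \<longrightarrow> x \<noteq> y \<longrightarrow> 0 < t \<longrightarrow> t < 1 \<longrightarrow>
        norm (t *\<^sub>R x + (1 - t) *\<^sub>R y) < 1)"

definition gateaux_differentiable_space :: "'a::real_normed_vector itself \<Rightarrow> bool" where
  "gateaux_differentiable_space _ \<longleftrightarrow>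
     (\<forall>x::'a. x \<noteq> 0 \<longrightarrow> gateaux_differentiable_at (\<lambda>z::'a. ereal (norm z)) x)"

definition gauge_potential :: "(real \<Rightarrow> real) \<Rightarrow> 'a::real_normed_vector \<Rightarrow> ereal" where
  "gauge_potential \<phi> x = ereal (integral {0..norm x} \<phi>)"

definition convex_conjugate ::
    "('a::real_normed_vector \<Rightarrow> ereal) \<Rightarrow> ('a \<Rightarrow>\<^sub>L real) \<Rightarrow> ereal" where
  "convex_conjugate \<Psi> y = (SUP x. ereal (blinfun_apply y x) - \<Psi> x)"

definition duality_map :: "(real \<Rightarrow> real) \<Rightarrow> 'a::real_normed_vector \<Rightarrow> ('a \<Rightarrow>\<^sub>L real) set" where
  "duality_map \<phi> x = {y. blinfun_apply y x = norm x * norm y \<and> norm y = \<phi> (norm x)}"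

text \<open>The value \<open>\<infinity>\<close> at points \<open>y\<close> where \<open>\<Psi>\<close> is not finite or not Gateaux differentiable
  never occurs for finite Gateaux differentiable \<open>\<Psi>\<close>. It ensures that statements about the
  divergence, such as \<open>D \<Psi> y y = 0\<close>, cannot hold through an arbitrary choice of derivative.\<close>

definition bregman :: "('a::real_normed_vector \<Rightarrow> ereal) \<Rightarrow> 'a \<Rightarrow> 'a \<Rightarrow> ereal" where
  "bregman \<Psi> x y =
     (if gateaux_differentiable_at \<Psi> y
      then \<Psi> x - \<Psi> y - ereal (blinfun_apply (gateaux_deriv \<Psi> y) (x - y))
      else \<infinity>)"

definition is_information_on :: "('a \<Rightarrow> 'a \<Rightarrow> ereal) \<Rightarrow> 'a set \<Rightarrow> bool" where
  "is_information_on D Z \<longleftrightarrow> (\<forall>x\<in>Z. \<forall>y\<in>Z. D x y = 0 \<longleftrightarrow> x = y)"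

definition left_chebyshev :: "('a::real_normed_vector \<Rightarrow> ereal) \<Rightarrow> 'a set \<Rightarrow> bool" where
  "left_chebyshev \<Psi> K \<longleftrightarrow> (\<forall>y. \<exists>!x. is_arg_min (\<lambda>x. bregman \<Psi> x y) (\<lambda>x. x \<in> K) x)"

definition right_chebyshev :: "('a::real_normed_vector \<Rightarrow> ereal) \<Rightarrow> 'a set \<Rightarrow> bool" where
  "right_chebyshev \<Psi> K \<longleftrightarrow> (\<forall>y. \<exists>!x. is_arg_min (\<lambda>x. bregman \<Psi> y x) (\<lambda>x. x \<in> K) x)"

definition left_projection :: "('a::real_normed_vector \<Rightarrow> ereal) \<Rightarrow> 'a set \<Rightarrow> 'a \<Rightarrow> 'a" where
  "left_projection \<Psi> K y = arg_min_on (\<lambda>x. bregman \<Psi> x y) K"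

definition right_projection :: "('a::real_normed_vector \<Rightarrow> ereal) \<Rightarrow> 'a set \<Rightarrow> 'a \<Rightarrow> 'a" where
  "right_projection \<Psi> K y = arg_min_on (\<lambda>x. bregman \<Psi> y x) K"

definition is_the_unique :: "'a \<Rightarrow> 'a set \<Rightarrow> ('a \<Rightarrow> bool) \<Rightarrow> bool" where
  "is_the_unique w K P \<longleftrightarrow> w \<in> K \<and> P w \<and> (\<forall>z\<in>K. P z \<longrightarrow> z = w)"

definition left_pythagorean :: "('a::real_normed_vector \<Rightarrow> ereal) \<Rightarrow> 'a set \<Rightarrow> bool" where
  "left_pythagorean \<Psi> K \<longleftrightarrow>
     left_chebyshev \<Psi> K \<and>
     (\<forall>x \<in> interior (effective_domain \<Psi>). \<forall>w\<in>K.
        (w = left_projection \<Psi> K x \<longleftrightarrow>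
           is_the_unique w K (\<lambda>z. \<forall>y\<in>K.
             0 \<le> blinfun_apply (gateaux_deriv \<Psi> x - gateaux_deriv \<Psi> z) (z - y))) \<and>
        (w = left_projection \<Psi> K x \<longleftrightarrow>
           is_the_unique w K (\<lambda>z. \<forall>y\<in>K.
             bregman \<Psi> y z + bregman \<Psi> z x \<le> bregman \<Psi> y x)))"

definition right_pythagorean :: "('a::real_normed_vector \<Rightarrow> ereal) \<Rightarrow> 'a set \<Rightarrow> bool" where
  "right_pythagorean \<Psi> K \<longleftrightarrow>
     right_chebyshev \<Psi> K \<and>
     (\<forall>x \<in> interior (effective_domain \<Psi>). \<forall>w\<in>K.
        (w = right_projection \<Psi> K x \<longleftrightarrow>
           is_the_unique w K (\<lambda>z. \<forall>y\<in>K.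
             0 \<le> blinfun_apply (gateaux_deriv \<Psi> z - gateaux_deriv \<Psi> y) (x - z))) \<and>
        (w = right_projection \<Psi> K x \<longleftrightarrow>
           is_the_unique w K (\<lambda>z. \<forall>y\<in>K.
             bregman \<Psi> x z + bregman \<Psi> z y \<le> bregman \<Psi> x y)))"

definition zone_consistent :: "('a::real_normed_vector \<Rightarrow> ereal) \<Rightarrow> ('a \<Rightarrow> 'a) \<Rightarrow> bool" where
  "zone_consistent \<Psi> P \<longleftrightarrow>
     P ` interior (effective_domain \<Psi>) \<subseteq> interior (effective_domain \<Psi>)"

end

theory Submission
  imports Defs
begin

text \<open>A strictly convex, supercoercive and Gateaux differentiable potential \<open>f\<close> on a reflexive space,
  minus a continuous linear functional, attains its minimum on every nonempty closed convex set: the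
  sublevel sets are nested, bounded, closed and convex, hence have a common point. Minimisers are
  characterised by the variational inequality of the left pythagorean property, which by the
  three-point identity of the divergence is equivalent to the pythagorean inequality. Taking the whole
  space as the set shows that the derivative is a bijection onto the dual. The conjugate
  of \<open>f\<close> is again such a potential, with the inverse bijection as derivative, and
  \<open>D\<^sub>f(x, y) = D\<^bsub>f*\<^esub>(f' y, f' x)\<close> turns right projections into left ones. The functional-analytic
  input is the Hahn-Banach theorem in the form that every sublinear functional dominates a linear
  one; directional derivatives of convex functions are sublinear.\<close>

section \<open>Sublinear functionals and the Hahn-Banach theorem\<close>

definition sublinear :: "('a::real_vector \<Rightarrow> real) \<Rightarrow> bool" where
  "sublinear p \<longleftrightarrow>
     (\<forall>x y. p (x + y) \<le> p x + p y) \<and> (\<forall>c x. 0 \<le> c \<longrightarrow> p (c *\<^sub>R x) = c * p x)"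

lemma sublinear_add: "sublinear p \<Longrightarrow> p (x + y) \<le> p x + p y"
  and sublinear_scale: "sublinear p \<Longrightarrow> 0 \<le> c \<Longrightarrow> p (c *\<^sub>R x) = c * p x"
  by (auto simp: sublinear_def)

lemma sublinear_zero: "sublinear p \<Longrightarrow> p 0 = 0"
  using sublinear_scale[of p 0 0] by simp

lemma sublinear_minus: "sublinear p \<Longrightarrow> - p (- x) \<le> p x"
  using sublinear_add[of p x "- x"] sublinear_zero[of p] by simp

lemma sublinearI:
  assumes add: "\<And>x y. p (x + y) \<le> p x + p y"
    and scale: "\<And>c x. 0 < c \<Longrightarrow> p (c *\<^sub>R x) \<le> c * p x"
    and zero: "p 0 = 0"
  shows "sublinear p"
proof -
  have "p (c *\<^sub>R x) = c * p x" if "0 \<le> c" for c x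
  proof (cases "c = 0")
    case False
    with that have c: "0 < c" by simp
    have "p x \<le> inverse c * p (c *\<^sub>R x)"
      using scale[of "inverse c" "c *\<^sub>R x"] c by simp
    then have "c * p x \<le> p (c *\<^sub>R x)"
      using c by (simp add: field_simps)
    with scale[OF c, of x] show ?thesis by simp
  qed (simp add: zero)
  with add show ?thesis by (auto simp: sublinear_def)
qed

text \<open>Supplies the bounds that Zorn's lemma asks for. Subadditivity gives
  \<open>- p (- x) \<le> q x\<close>, which keeps the infimum finite; comparability lets one member
  of the chain replace two when subadditivity is checked.\<close>

lemma sublinear_INF_chain:
  assumes "C \<noteq> {}" and sub: "\<And>q. q \<in> C \<Longrightarrow> sublinear q"
    and le: "\<And>q. q \<in> C \<Longrightarrow> q \<le> p"
    and chain: "\<And>q r. q \<in> C \<Longrightarrow> r \<in> C \<Longrightarrow> q \<le> r \<or> r \<le> q"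
  shows "sublinear (\<lambda>x. INF q\<in>C. q x) \<and> (\<forall>q\<in>C. (\<lambda>x. INF q\<in>C. q x) \<le> q)"
proof -
  let ?u = "\<lambda>x. INF q\<in>C. q x"
  have lower: "- p (- x) \<le> q x" if "q \<in> C" for q x
    using sublinear_minus[OF sub[OF that], of x] le_funD[OF le[OF that], of "- x"] by linarith
  then have bdd: "bdd_below ((\<lambda>q. q x) ` C)" for x
    by (auto simp: bdd_below_def)
  have u_le: "?u x \<le> q x" if "q \<in> C" for q x
    using bdd that by (rule cINF_lower)
  have add: "?u (x + y) \<le> ?u x + ?u y" for x y
  proof -
    have "?u (x + y) \<le> q x + r y" if qr: "q \<in> C" "r \<in> C" for q r
    proof -
      obtain s where s: "s \<in> C" "s \<le> q" "s \<le> r"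
        using chain[OF qr] qr by blast
      have "?u (x + y) \<le> s (x + y)" using s u_le by blast
      also have "\<dots> \<le> s x + s y" using s sub sublinear_add by blast
      also have "\<dots> \<le> q x + r y" using s by (auto simp: le_fun_def intro: add_mono)
      finally show ?thesis .
    qed
    then have "?u (x + y) - r y \<le> ?u x" if "r \<in> C" for r
      using that by (intro cINF_greatest[OF \<open>C \<noteq> {}\<close>]) (simp add: diff_le_eq)
    then have "?u (x + y) - ?u x \<le> ?u y"
      by (intro cINF_greatest[OF \<open>C \<noteq> {}\<close>]) (smt (verit))
    then show ?thesis by simp
  qed
  have scale: "?u (c *\<^sub>R x) \<le> c * ?u x" if "0 < c" for c x
  proof -
    have "?u (c *\<^sub>R x) / c \<le> q x" if "q \<in> C" for q
      using u_le[OF that, of "c *\<^sub>R x"] sublinear_scale[OF sub[OF that], of c x] \<open>0 < c\<close>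
      by (simp add: divide_le_eq mult.commute)
    then have "?u (c *\<^sub>R x) / c \<le> ?u x"
      by (intro cINF_greatest[OF \<open>C \<noteq> {}\<close>])
    then show ?thesis using that by (simp add: divide_le_eq mult.commute)
  qed
  have "(\<lambda>q. q 0) ` C = {0}"
    using sub sublinear_zero \<open>C \<noteq> {}\<close> by fastforce
  then have "?u 0 = 0" by simp
  with add scale have "sublinear ?u" by (intro sublinearI) auto
  with u_le show ?thesis by (auto simp: le_fun_def)
qed

text \<open>Taking \<open>t = 0\<close> bounds \<open>r\<close> by \<open>q\<close>, and
  \<open>t = 1\<close> gives superadditivity in the direction \<open>y\<close>. Hence a
  \<open>q\<close> that no shift lowers is additive.\<close>

lemma sublinear_shift:
  fixes y :: "'a::real_vector"
  assumes q: "sublinear q"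
  defines "r \<equiv> \<lambda>x. INF t\<in>{0..}. q (x + t *\<^sub>R y) - t * q y"
  shows "sublinear r" and "r \<le> q" and "r x + q y \<le> q (x + y)"
proof -
  have "- q (- x) \<le> q (x + t *\<^sub>R y) - t * q y" if "0 \<le> t" for x t
    using sublinear_add[OF q, of "- x" "x + t *\<^sub>R y"] sublinear_scale[OF q that, of y] by simp
  then have bdd: "bdd_below ((\<lambda>t. q (x + t *\<^sub>R y) - t * q y) ` {0..})" for x
    by (auto simp: bdd_below_def)
  have r_le: "r x \<le> q (x + t *\<^sub>R y) - t * q y" if "0 \<le> t" for x t
    unfolding r_def using that by (intro cINF_lower[OF bdd]) auto
  show "r \<le> q" using r_le[of 0] by (auto simp: le_fun_def)
  show "r x + q y \<le> q (x + y)" using r_le[of 1 x] by simp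
  have r_ge: "c \<le> r x" if "\<And>t. 0 \<le> t \<Longrightarrow> c \<le> q (x + t *\<^sub>R y) - t * q y" for c x
    unfolding r_def using that by (intro cINF_greatest) auto
  show "sublinear r"
  proof (rule sublinearI)
    fix x z
    have "r (x + z) \<le> (q (x + s *\<^sub>R y) - s * q y) + (q (z + t *\<^sub>R y) - t * q y)"
      if "0 \<le> s" "0 \<le> t" for s t
    proof -
      have "r (x + z) \<le> q (x + z + (s + t) *\<^sub>R y) - (s + t) * q y"
        using that by (intro r_le) auto
      also have "x + z + (s + t) *\<^sub>R y = (x + s *\<^sub>R y) + (z + t *\<^sub>R y)"
        by (simp add: algebra_simps)
      finally show ?thesis
        using sublinear_add[OF q, of "x + s *\<^sub>R y" "z + t *\<^sub>R y"] by (simp add: algebra_simps)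
    qed
    then have "r (x + z) - (q (z + t *\<^sub>R y) - t * q y) \<le> r x" if "0 \<le> t" for t
      using that by (intro r_ge) (simp add: diff_le_eq)
    then have "r (x + z) - r x \<le> r z"
      by (intro r_ge) (smt (verit))
    then show "r (x + z) \<le> r x + r z" by simp
  next
    fix c :: real and x assume c: "0 < c"
    have "r (c *\<^sub>R x) / c \<le> r x"
    proof (rule r_ge)
      fix t :: real assume t: "0 \<le> t"
      have "r (c *\<^sub>R x) \<le> q (c *\<^sub>R x + (c * t) *\<^sub>R y) - (c * t) * q y"
        using c t by (intro r_le) auto
      also have "c *\<^sub>R x + (c * t) *\<^sub>R y = c *\<^sub>R (x + t *\<^sub>R y)"
        by (simp add: scaleR_add_right)
      also have "q \<dots> - (c * t) * q y = c * (q (x + t *\<^sub>R y) - t * q y)"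
        using sublinear_scale[OF q, of c "x + t *\<^sub>R y"] c by (simp add: right_diff_distrib)
      finally show "r (c *\<^sub>R x) / c \<le> q (x + t *\<^sub>R y) - t * q y"
        using c by (simp add: divide_le_eq mult.commute)
    qed
    then show "r (c *\<^sub>R x) \<le> c * r x" using c by (simp add: divide_le_eq mult.commute)
  next
    show "r 0 = 0"
      using r_le[of 0 0] sublinear_zero[OF q] sublinear_scale[OF q]
      by (intro antisym r_ge) auto
  qed
qed

text \<open>A minimal sublinear functional is linear, because it coincides with all its shifts.\<close>

theorem hahn_banach_sublinear:
  fixes p :: "'a::real_vector \<Rightarrow> real"
  assumes p: "sublinear p"
  obtains F where "linear F" and "\<And>x. F x \<le> p x"
proof -
  let ?A = "{q. sublinear q \<and> q \<le> p}"
  \<comment> \<open>The order is reversed so that Zorn's lemma produces a minimal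
    functional.\<close>
  let ?P = "\<lambda>q r :: 'a \<Rightarrow> real. r \<le> q"
  have "\<exists>m\<in>?A. \<forall>a\<in>?A. ?P m a \<longrightarrow> a = m"
  proof (rule predicate_Zorn)
    show "partial_order_on ?A (relation_of ?P ?A)"
      by (rule partial_order_on_relation_ofI) auto
    fix C assume C: "C \<in> Chains (relation_of ?P ?A)"
    then have sub: "\<And>q. q \<in> C \<Longrightarrow> sublinear q \<and> q \<le> p"
      and chain: "\<And>q r. q \<in> C \<Longrightarrow> r \<in> C \<Longrightarrow> q \<le> r \<or> r \<le> q"
      by (auto simp: Chains_def relation_of_def)
    show "\<exists>u\<in>?A. \<forall>a\<in>C. u \<le> a"
    proof (cases "C = {}")
      case True
      then show ?thesis using p by auto
    next
      case False
      have "sublinear (\<lambda>x. INF q\<in>C. q x) \<and> (\<forall>q\<in>C. (\<lambda>x. INF q\<in>C. q x) \<le> q)"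
        by (rule sublinear_INF_chain[where p = p]) (use False sub chain in auto)
      then show ?thesis
        using False sub by (intro bexI[of _ "\<lambda>x. INF q\<in>C. q x"]) (auto intro: order_trans)
    qed
  qed
  then obtain m where m: "sublinear m" "m \<le> p"
    and min: "\<And>q. sublinear q \<Longrightarrow> q \<le> p \<Longrightarrow> q \<le> m \<Longrightarrow> q = m"
    by auto
  have "m (x + y) = m x + m y" for x y
  proof -
    define r where "r = (\<lambda>x. INF t\<in>{0..}. m (x + t *\<^sub>R y) - t * m y)"
    have "r = m"
      using sublinear_shift[OF m(1), of y] m(2) by (intro min) (auto simp: r_def)
    moreover have "r x + m y \<le> m (x + y)"
      unfolding r_def by (rule sublinear_shift(3)[OF m(1)])
    ultimately show ?thesis using sublinear_add[OF m(1), of x y] by simp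
  qed
  note add = this
  have minus: "m (- x) = - m x" for x
    using add[of x "- x"] sublinear_zero[OF m(1)] by simp
  have "m (c *\<^sub>R x) = c * m x" for c x
    using sublinear_scale[OF m(1), of c x] sublinear_scale[OF m(1), of "- c" x] minus[of "c *\<^sub>R x"]
    by (cases "0 \<le> c") auto
  with add have "linear m" by (intro linearI) auto
  with m(2) that show ?thesis by (auto simp: le_fun_def)
qed

section \<open>Directional derivatives and subgradients of convex functions\<close>

text \<open>For convex \<open>f\<close> the quotients shrink with \<open>t\<close>, so the infimum
  is the right-hand directional derivative. In this form any single \<open>t\<close> gives an upper
  bound.\<close>

definition dir_deriv :: "('a::real_vector \<Rightarrow> real) \<Rightarrow> 'a \<Rightarrow> 'a \<Rightarrow> real" where
  "dir_deriv f x h = (INF t\<in>{0<..}. (f (x + t *\<^sub>R h) - f x) / t)"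

text \<open>\<open>x\<close> is the convex combination of \<open>x - h\<close> and
  \<open>x + t *\<^sub>R h\<close> with weights \<open>t / (1 + t)\<close> and
  \<open>1 / (1 + t)\<close>. The bound is independent of \<open>t\<close>, so the infimum in
  \<open>dir_deriv\<close> is a genuine one.\<close>

lemma convex_diff_quotient_lower:
  fixes f :: "'a::real_vector \<Rightarrow> real"
  assumes f: "convex_on UNIV f" and t: "0 < t"
  shows "f x - f (x - h) \<le> (f (x + t *\<^sub>R h) - f x) / t"
proof -
  have "f (((t / (1 + t)) *\<^sub>R (x - h)) + (1 / (1 + t)) *\<^sub>R (x + t *\<^sub>R h))
      \<le> (t / (1 + t)) * f (x - h) + (1 / (1 + t)) * f (x + t *\<^sub>R h)"
    using f[unfolded convex_on_def, THEN conjunct2, rule_format, of "x - h" "x + t *\<^sub>R h" "t / (1 + t)" "1 / (1 + t)"] t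
    by (simp add: add_divide_distrib[symmetric])
  also have "((t / (1 + t)) *\<^sub>R (x - h)) + (1 / (1 + t)) *\<^sub>R (x + t *\<^sub>R h)
      = (t / (1 + t) + 1 / (1 + t)) *\<^sub>R x"
    by (simp add: algebra_simps)
  also have "t / (1 + t) + 1 / (1 + t) = 1" using t by (simp flip: add_divide_distrib)
  also have "t / (1 + t) * f (x - h) + 1 / (1 + t) * f (x + t *\<^sub>R h)
      = (t * f (x - h) + f (x + t *\<^sub>R h)) / (1 + t)"
    by (simp add: add_divide_distrib)
  finally have "(f x - f (x - h)) * t \<le> f (x + t *\<^sub>R h) - f x"
    using t by (simp add: pos_le_divide_eq algebra_simps)
  then show ?thesis using t by (simp add: pos_le_divide_eq)
qed

lemma convex_diff_quotient_mono:
  fixes f :: "'a::real_vector \<Rightarrow> real"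
  assumes f: "convex_on UNIV f" and "0 < t" "t \<le> s"
  shows "(f (x + t *\<^sub>R h) - f x) / t \<le> (f (x + s *\<^sub>R h) - f x) / s"
proof -
  have "f ((1 - t / s) *\<^sub>R x + (t / s) *\<^sub>R (x + s *\<^sub>R h)) \<le> (1 - t / s) * f x + (t / s) * f (x + s *\<^sub>R h)"
    using assms by (intro convex_onD[OF f]) auto
  also have "(1 - t / s) *\<^sub>R x + (t / s) *\<^sub>R (x + s *\<^sub>R h) = x + t *\<^sub>R h"
    using assms by (simp add: algebra_simps)
  finally show ?thesis using assms by (simp add: field_simps)
qed

context
  fixes f :: "'a::real_vector \<Rightarrow> real"
  assumes f: "convex_on UNIV f"
begin

lemma dir_deriv_le: "0 < t \<Longrightarrow> dir_deriv f x h \<le> (f (x + t *\<^sub>R h) - f x) / t"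
  unfolding dir_deriv_def
  by (rule cINF_lower) (auto simp: bdd_below_def intro: convex_diff_quotient_lower[OF f])

lemma dir_deriv_ge:
  "(\<And>t. 0 < t \<Longrightarrow> c \<le> (f (x + t *\<^sub>R h) - f x) / t) \<Longrightarrow> c \<le> dir_deriv f x h"
  unfolding dir_deriv_def by (rule cINF_greatest) auto

lemma dir_deriv_le_diff: "dir_deriv f x h \<le> f (x + h) - f x"
  using dir_deriv_le[of 1] by simp

text \<open>With \<open>r = s * t / (s + t)\<close>, the point
  \<open>x + r *\<^sub>R (h + k)\<close> is a convex combination of \<open>x + s *\<^sub>R h\<close>
  and \<open>x + t *\<^sub>R k\<close>. As \<open>s\<close> and \<open>t\<close> are independent,
  the two infima can be taken in turn.\<close>

lemma sublinear_dir_deriv: "sublinear (dir_deriv f x)"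
proof (rule sublinearI)
  fix h k
  have "dir_deriv f x (h + k) \<le> (f (x + s *\<^sub>R h) - f x) / s + (f (x + t *\<^sub>R k) - f x) / t"
    if st: "0 < s" "0 < t" for s t
  proof -
    define r where "r = s * t / (s + t)"
    have r: "0 < r" using st by (simp add: r_def)
    have rs: "t / (s + t) = r / s" "s / (s + t) = r / t" using st by (simp_all add: r_def)
    have sum1: "t / (s + t) + s / (s + t) = 1" using st by (simp flip: add_divide_distrib)
    have "f ((1 - s / (s + t)) *\<^sub>R (x + s *\<^sub>R h) + (s / (s + t)) *\<^sub>R (x + t *\<^sub>R k))
        \<le> (1 - s / (s + t)) * f (x + s *\<^sub>R h) + (s / (s + t)) * f (x + t *\<^sub>R k)"
      using st by (intro convex_onD[OF f]) auto
    also have "1 - s / (s + t) = t / (s + t)"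
      using st by (simp add: field_simps)
    also have "(t / (s + t)) *\<^sub>R (x + s *\<^sub>R h) + (s / (s + t)) *\<^sub>R (x + t *\<^sub>R k)
       = (t / (s + t) + s / (s + t)) *\<^sub>R x + r *\<^sub>R (h + k)"
      by (simp add: algebra_simps r_def)
    also note sum1
    finally have "f (x + r *\<^sub>R (h + k)) - f x
        \<le> t / (s + t) * (f (x + s *\<^sub>R h) - f x) + s / (s + t) * (f (x + t *\<^sub>R k) - f x)"
      using arg_cong[OF sum1, of "\<lambda>u. u * f x"]
      by (simp only: distrib_right right_diff_distrib mult_1 scaleR_one)
    also have "\<dots> = r * ((f (x + s *\<^sub>R h) - f x) / s + (f (x + t *\<^sub>R k) - f x) / t)"
      using rs by (simp add: distrib_left)
    finally have "(f (x + r *\<^sub>R (h + k)) - f x) / r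
        \<le> (f (x + s *\<^sub>R h) - f x) / s + (f (x + t *\<^sub>R k) - f x) / t"
      using r by (simp add: divide_le_eq mult.commute)
    then show ?thesis using dir_deriv_le[OF r, of x "h + k"] by linarith
  qed
  then have "dir_deriv f x (h + k) - (f (x + t *\<^sub>R k) - f x) / t \<le> dir_deriv f x h" if "0 < t" for t
    using that by (intro dir_deriv_ge) (simp add: diff_le_eq)
  then have "dir_deriv f x (h + k) - dir_deriv f x h \<le> dir_deriv f x k"
    by (intro dir_deriv_ge) (smt (verit))
  then show "dir_deriv f x (h + k) \<le> dir_deriv f x h + dir_deriv f x k" by simp
next
  fix c :: real and h assume c: "0 < c"
  have "dir_deriv f x (c *\<^sub>R h) / c \<le> dir_deriv f x h"
  proof (rule dir_deriv_ge)
    fix t :: real assume t: "0 < t"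
    have "dir_deriv f x (c *\<^sub>R h) \<le> (f (x + (t / c) *\<^sub>R (c *\<^sub>R h)) - f x) / (t / c)"
      using c t by (intro dir_deriv_le) auto
    then show "dir_deriv f x (c *\<^sub>R h) / c \<le> (f (x + t *\<^sub>R h) - f x) / t"
      using c by (simp add: field_simps)
  qed
  then show "dir_deriv f x (c *\<^sub>R h) \<le> c * dir_deriv f x h"
    using c by (simp add: divide_le_eq mult.commute)
next
  show "dir_deriv f x 0 = 0"
    by (simp add: dir_deriv_def)
qed

lemma subgradient_exists:
  obtains F where "linear F" and "\<And>h. F h \<le> f (x + h) - f x"
  using hahn_banach_sublinear[OF sublinear_dir_deriv[of x]] dir_deriv_le_diff[of x]
  by (metis order_trans)

end

lemma sublinear_convex: "sublinear p \<Longrightarrow> convex_on UNIV p"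
  by (auto simp: convex_on_def sublinear_def intro: order_trans[OF sublinear_add])

text \<open>Obtained from a subgradient of \<open>f'(x; \<cdot>)\<close> at \<open>h\<close>.\<close>

lemma subgradient_touching:
  fixes f :: "'a::real_vector \<Rightarrow> real"
  assumes f: "convex_on UNIV f"
  obtains F where "linear F" and "\<And>k. F k \<le> f (x + k) - f x" and "F h = dir_deriv f x h"
proof -
  let ?p = "dir_deriv f x"
  have p: "sublinear ?p" by (rule sublinear_dir_deriv[OF f])
  obtain F where F: "linear F" "\<And>k. F k \<le> ?p (h + k) - ?p h"
    using subgradient_exists[OF sublinear_convex[OF p]] by metis
  have le: "F k \<le> ?p k" for k
    using F(2)[of k] sublinear_add[OF p, of h k] by linarith
  \<comment> \<open>The subgradient inequality of \<open>?p\<close> at \<open>h\<close>, read at the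
    origin, reverses \<open>F h \<le> ?p h\<close>.\<close>
  have "F (- h) \<le> - ?p h"
    using F(2)[of "- h"] sublinear_zero[OF p] by simp
  then have "F h = ?p h"
    using le[of h] linear_neg[OF F(1)] by simp
  moreover have "F k \<le> f (x + k) - f x" for k
    using le[of k] dir_deriv_le_diff[OF f, of x k] by linarith
  ultimately show ?thesis using that F(1) by blast
qed

section \<open>Continuous functionals, separation and nested convex sets\<close>

text \<open>An upper bound on the unit ball also applies to \<open>- x\<close>, so it bounds the
  absolute value. This turns the algebraic functionals from Hahn-Banach into elements of the
  dual.\<close>

lemma linear_bounded_above_blinfun:
  fixes F :: "'a::real_normed_vector \<Rightarrow> real"
  assumes F: "linear F" and bd: "\<And>h. norm h \<le> 1 \<Longrightarrow> F h \<le> B"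
  obtains y :: "'a \<Rightarrow>\<^sub>L real" where "\<And>h. blinfun_apply y h = F h"
proof -
  have "bounded_linear F"
  proof (rule bounded_linear_intro[where K = B])
    show "F (x + y) = F x + F y" for x y using F by (simp add: linear_add)
    show "F (c *\<^sub>R x) = c *\<^sub>R F x" for c x using F by (simp add: linear_cmul)
    fix x :: 'a
    have le: "F x \<le> norm x * B" for x
    proof (cases "x = 0")
      case False
      then have "F (x /\<^sub>R norm x) \<le> B" by (intro bd) simp
      then have "inverse (norm x) * F x \<le> B" using linear_cmul[OF F] by simp
      with False show ?thesis by (simp add: field_simps)
    qed (simp add: linear_0[OF F])
    then show "norm (F x) \<le> norm x * B"
      using le[of x] le[of "- x"] linear_neg[OF F] by (simp add: abs_le_iff)
  qed
  with that show ?thesis by (metis bounded_linear_Blinfun_apply)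
qed

lemma convex_infdist:
  fixes C :: "'a::real_normed_vector set"
  assumes "convex C" "C \<noteq> {}"
  shows "convex_on UNIV (\<lambda>x. infdist x C)"
proof (rule convex_onI)
  fix t :: real and x y :: 'a assume t: "0 < t" "t < 1"
  have inf: "infdist ((1 - t) *\<^sub>R x + t *\<^sub>R y) C \<le> (1 - t) * dist x a + t * dist y b"
    if "a \<in> C" "b \<in> C" for a b
  proof -
    have "(1 - t) *\<^sub>R a + t *\<^sub>R b \<in> C" using that t assms(1) by (auto simp: convex_def)
    then have "infdist ((1 - t) *\<^sub>R x + t *\<^sub>R y) C
        \<le> dist ((1 - t) *\<^sub>R x + t *\<^sub>R y) ((1 - t) *\<^sub>R a + t *\<^sub>R b)"
      by (rule infdist_le)
    also have "\<dots> = norm ((1 - t) *\<^sub>R (x - a) + t *\<^sub>R (y - b))"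
      by (simp add: dist_norm algebra_simps)
    also have "\<dots> \<le> (1 - t) * dist x a + t * dist y b"
      using t by (intro norm_triangle_le) (simp add: dist_norm)
    finally show ?thesis .
  qed
  let ?i = "infdist ((1 - t) *\<^sub>R x + t *\<^sub>R y) C"
  have "(?i - t * dist y b) / (1 - t) \<le> infdist x C" if "b \<in> C" for b
    unfolding infdist_notempty[OF assms(2), of x]
    using inf that t by (intro cINF_greatest assms(2)) (simp add: divide_le_eq algebra_simps)
  then have "?i - t * dist y b \<le> (1 - t) * infdist x C" if "b \<in> C" for b
    using that t by (simp add: divide_le_eq algebra_simps)
  then have "(?i - (1 - t) * infdist x C) / t \<le> dist y b" if "b \<in> C" for b
    using that t by (simp add: divide_le_eq algebra_simps)
  then have "(?i - (1 - t) * infdist x C) / t \<le> infdist y C"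
    unfolding infdist_notempty[OF assms(2), of y] by (intro cINF_greatest assms(2))
  then show "?i \<le> (1 - t) * infdist x C + t * infdist y C"
    using t by (simp add: divide_le_eq algebra_simps)
qed auto

text \<open>The functional is a subgradient at \<open>x\<close> of the distance to \<open>C\<close>.
  That function is 1-Lipschitz, which gives continuity, and vanishes on \<open>C\<close>, so the gap
  is the distance of \<open>x\<close> from \<open>C\<close>.\<close>

lemma closed_convex_separation:
  fixes C :: "'a::real_normed_vector set"
  assumes "convex C" "closed C" "C \<noteq> {}" "x \<notin> C"
  obtains y :: "'a \<Rightarrow>\<^sub>L real" and d where "0 < d" and "\<And>c. c \<in> C \<Longrightarrow> blinfun_apply y c \<le> blinfun_apply y x - d"
proof -
  obtain F where F: "linear F" "\<And>h. F h \<le> infdist (x + h) C - infdist x C"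
    using subgradient_exists[OF convex_infdist[OF assms(1,3)]] by metis
  have "F h \<le> 1" if "norm h \<le> 1" for h
    using F(2)[of h] infdist_triangle[of "x + h" C x] that by (simp add: dist_norm)
  then obtain y :: "'a \<Rightarrow>\<^sub>L real" where y: "\<And>h. blinfun_apply y h = F h"
    using linear_bounded_above_blinfun[OF F(1)] by metis
  have "blinfun_apply y c \<le> blinfun_apply y x - infdist x C" if "c \<in> C" for c
    using F(2)[of "c - x"] that by (simp add: y[symmetric] blinfun.diff_right)
  moreover have "0 < infdist x C"
    using assms by (metis in_closed_iff_infdist_zero infdist_nonneg less_eq_real_def)
  ultimately show ?thesis using that by blast
qed

text \<open>Smulian's theorem. A linear functional below \<open>y \<mapsto> inf\<^sub>n sup\<^bsub>C n\<^esub> y\<close> on the dual is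
  evaluation at a point, which separation places in every \<open>C n\<close>.\<close>

theorem reflexive_nested_intersection:
  fixes C :: "nat \<Rightarrow> 'a::real_normed_vector set"
  assumes refl: "reflexive_space TYPE('a)"
    and conv: "\<And>n. convex (C n)" and cl: "\<And>n. closed (C n)" and ne: "\<And>n. C n \<noteq> {}"
    and dec: "\<And>m n. m \<le> n \<Longrightarrow> C n \<subseteq> C m" and bd: "bounded (C 0)"
  obtains x where "\<And>n. x \<in> C n"
proof -
  obtain B where B: "\<And>x. x \<in> C 0 \<Longrightarrow> norm x \<le> B" using bd by (auto simp: bounded_iff)
  have B': "norm x \<le> B" if "x \<in> C n" for x n using that dec[of 0 n] B by auto
  have ab: "\<bar>blinfun_apply y x\<bar> \<le> norm y * B" if "x \<in> C n" for x y n
    using norm_blinfun[of y x] mult_left_mono[OF B'[OF that] norm_ge_zero[of y]] by simp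
  define s where "s n y = (SUP x\<in>C n. blinfun_apply y x)" for n and y :: "'a \<Rightarrow>\<^sub>L real"
  define p where "p y = (INF n. s n y)" for y :: "'a \<Rightarrow>\<^sub>L real"
  have s_upper: "blinfun_apply y x \<le> s n y" if "x \<in> C n" for x n y
    unfolding s_def
    by (rule cSUP_upper[OF that], rule bdd_aboveI2[where M = "norm y * B"], rule abs_le_D1, rule ab)
  have s_least: "s n y \<le> c" if "\<And>x. x \<in> C n \<Longrightarrow> blinfun_apply y x \<le> c" for c n y
    unfolding s_def using that by (intro cSUP_least ne)
  have s_lower: "- (norm y * B) \<le> s n y" for n y
  proof -
    obtain x where "x \<in> C n" using ne by blast
    then show ?thesis using s_upper[of x n y] ab[of x n y] by linarith
  qed
  then have bdd: "bdd_below (range (\<lambda>n. s n y))" for y by (auto simp: bdd_below_def)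
  have p_le: "p y \<le> s n y" for n y unfolding p_def by (rule cINF_lower[OF bdd]) auto
  have p_ge: "c \<le> p y" if "\<And>n. c \<le> s n y" for c y
    unfolding p_def using that by (intro cINF_greatest) auto
  have p_bd: "p y \<le> norm y * B" for y
    by (rule order_trans[OF p_le[of y 0]], rule s_least, rule abs_le_D1, rule ab)
  have "sublinear p"
  proof (rule sublinearI)
    fix y z :: "'a \<Rightarrow>\<^sub>L real"
    have "p (y + z) \<le> s m y + s n z" for m n
    proof (rule order_trans[OF p_le[of _ "max m n"]], rule s_least)
      fix x assume "x \<in> C (max m n)"
      then have "x \<in> C m" "x \<in> C n" using dec[of m "max m n"] dec[of n "max m n"] by auto
      then show "blinfun_apply (y + z) x \<le> s m y + s n z"
        using s_upper by (simp add: blinfun.add_left add_mono)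
    qed
    then have "p (y + z) - s n z \<le> p y" for n by (intro p_ge) (simp add: diff_le_eq)
    then have "p (y + z) - p y \<le> p z" by (intro p_ge) (smt (verit))
    then show "p (y + z) \<le> p y + p z" by simp
  next
    fix c :: real and y :: "'a \<Rightarrow>\<^sub>L real" assume c: "0 < c"
    have "p (c *\<^sub>R y) \<le> c * s n y" for n
      by (rule order_trans[OF p_le[of _ n]], rule s_least)
        (use c s_upper in \<open>auto simp: blinfun.scaleR_left intro: mult_left_mono\<close>)
    then have "p (c *\<^sub>R y) / c \<le> p y"
      using c by (intro p_ge) (simp add: divide_le_eq mult.commute)
    then show "p (c *\<^sub>R y) \<le> c * p y" using c by (simp add: divide_le_eq mult.commute)
  next
    show "p 0 = 0" by (simp add: p_def s_def ne)
  qed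
  then obtain F where F: "linear F" "\<And>y. F y \<le> p y" using hahn_banach_sublinear by metis
  have "F y \<le> \<bar>B\<bar>" if "norm y \<le> 1" for y
  proof -
    have "norm y * B \<le> norm y * \<bar>B\<bar>" by (intro mult_left_mono) auto
    also have "\<dots> \<le> 1 * \<bar>B\<bar>" using that by (intro mult_right_mono) auto
    finally show ?thesis using F(2)[of y] p_bd[of y] by linarith
  qed
  then obtain \<xi> :: "('a \<Rightarrow>\<^sub>L real) \<Rightarrow>\<^sub>L real" where \<xi>: "\<And>y. blinfun_apply \<xi> y = F y"
    using linear_bounded_above_blinfun[OF F(1)] by metis
  then obtain x where x: "\<And>y. blinfun_apply y x = F y"
    using refl by (metis reflexive_space_def)
  have "x \<in> C n" for n
  proof (rule ccontr)
    assume x': "x \<notin> C n"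
    \<comment> \<open>Separation puts \<open>s n y\<close> below
      \<open>blinfun_apply y x = F y\<close>, against
      \<open>F y \<le> p y \<le> s n y\<close>.\<close>
    obtain y :: "'a \<Rightarrow>\<^sub>L real" and d where y: "0 < d" "\<And>c. c \<in> C n \<Longrightarrow> blinfun_apply y c \<le> blinfun_apply y x - d"
      using closed_convex_separation[OF conv cl ne x'] by blast
    then have "s n y \<le> blinfun_apply y x - d" by (intro s_least)
    then show False using F(2)[of y] p_le[of y n] x[of y] y(1) by linarith
  qed
  with that show ?thesis by blast
qed

section \<open>Differentiability from uniqueness of the subgradient\<close>

text \<open>The affine minorant at the convex combination \<open>w\<close> is evaluated at both end
  points; its linear terms cancel in the weighted sum.\<close>

lemma convex_on_if_subgradients:
  fixes f :: "'a::real_normed_vector \<Rightarrow> real" and G :: "'a \<Rightarrow> ('a \<Rightarrow>\<^sub>L real)"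
  assumes sub: "\<And>x z. f x + blinfun_apply (G x) (z - x) \<le> f z"
  shows "convex_on UNIV f"
proof (rule convex_onI)
  fix t :: real and x y :: 'a assume t: "0 < t" "t < 1"
  define w where "w = (1 - t) *\<^sub>R x + t *\<^sub>R y"
  have "(1 - t) * (f w + blinfun_apply (G w) (x - w)) + t * (f w + blinfun_apply (G w) (y - w))
      \<le> (1 - t) * f x + t * f y"
    using t by (intro add_mono mult_left_mono sub) auto
  moreover have "(1 - t) *\<^sub>R (x - w) + t *\<^sub>R (y - w) = 0"
    by (simp add: w_def algebra_simps)
  then have "(1 - t) * blinfun_apply (G w) (x - w) + t * blinfun_apply (G w) (y - w) = 0"
    by (metis blinfun.add_right blinfun.scaleR_right blinfun.zero_right real_scaleR_def)
  ultimately show "f ((1 - t) *\<^sub>R x + t *\<^sub>R y) \<le> (1 - t) * f x + t * f y"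
    unfolding w_def[symmetric] by (simp add: distrib_left left_diff_distrib)
qed auto

lemma dir_deriv_tendsto:
  fixes f :: "'a::real_vector \<Rightarrow> real"
  assumes f: "convex_on UNIV f"
  shows "((\<lambda>t. (f (x + t *\<^sub>R h) - f x) / t) \<longlongrightarrow> dir_deriv f x h) (at_right 0)"
proof (rule order_tendstoI)
  fix a assume "a < dir_deriv f x h"
  then have "a < (f (x + t *\<^sub>R h) - f x) / t" if "0 < t" for t
    using dir_deriv_le[OF f that, of x h] by linarith
  then show "\<forall>\<^sub>F t in at_right 0. a < (f (x + t *\<^sub>R h) - f x) / t"
    by (auto simp: eventually_at_filter)
next
  fix a assume "dir_deriv f x h < a"
  then obtain s where s: "0 < s" "(f (x + s *\<^sub>R h) - f x) / s < a"
    using dir_deriv_ge[OF f, of a x h] by (meson not_le)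
  have "(f (x + t *\<^sub>R h) - f x) / t < a" if "0 < t" "t < s" for t
    using convex_diff_quotient_mono[OF f, of t s x h] that s by simp
  then show "\<forall>\<^sub>F t in at_right 0. (f (x + t *\<^sub>R h) - f x) / t < a"
    using s(1) unfolding eventually_at_right_field by blast
qed

text \<open>For each direction \<open>h\<close> some subgradient attains the directional derivative.
  The bound \<open>B\<close> makes it continuous, so it is \<open>g\<close>. The left limit is the
  right limit in the direction \<open>- h\<close>, up to sign.\<close>

lemma derivative_if_unique_subgradient:
  fixes f :: "'a::real_normed_vector \<Rightarrow> real" and g :: "'a \<Rightarrow>\<^sub>L real"
  assumes f: "convex_on UNIV f" and bd: "\<And>k. norm k \<le> 1 \<Longrightarrow> f (x + k) \<le> B"
    and unique: "\<And>y. (\<And>k. blinfun_apply y k \<le> f (x + k) - f x) \<Longrightarrow> y = g"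
  shows "((\<lambda>t. (f (x + t *\<^sub>R h) - f x) / t) \<longlongrightarrow> blinfun_apply g h) (at 0)"
proof -
  have eq: "dir_deriv f x h = blinfun_apply g h" for h
  proof -
    obtain F where F: "linear F" "\<And>k. F k \<le> f (x + k) - f x" "F h = dir_deriv f x h"
      using subgradient_touching[OF f] by metis
    have "F k \<le> B - f x" if "norm k \<le> 1" for k
      using F(2)[of k] bd[OF that] by linarith
    then obtain y :: "'a \<Rightarrow>\<^sub>L real" where y: "\<And>k. blinfun_apply y k = F k"
      using linear_bounded_above_blinfun[OF F(1)] by metis
    with F(2) have "y = g" by (intro unique) simp
    with y F(3) show ?thesis by metis
  qed
  have right: "((\<lambda>t. (f (x + t *\<^sub>R h) - f x) / t) \<longlongrightarrow> blinfun_apply g h) (at_right 0)" for h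
    using dir_deriv_tendsto[OF f, of x h] by (simp add: eq)
  have "((\<lambda>t. - ((f (x + t *\<^sub>R (- h)) - f x) / t)) \<longlongrightarrow> - blinfun_apply g (- h)) (at_right 0)"
    by (intro tendsto_minus right)
  then have "((\<lambda>t. (f (x + t *\<^sub>R h) - f x) / t) \<longlongrightarrow> blinfun_apply g h) (at_left 0)"
    by (simp add: filterlim_at_left_to_right blinfun.minus_right)
  with right show ?thesis by (simp add: filterlim_at_split)
qed

section \<open>The canonical embedding into the bidual, and reflexivity of the dual\<close>

definition dual_eval :: "'a::real_normed_vector \<Rightarrow> (('a \<Rightarrow>\<^sub>L real) \<Rightarrow>\<^sub>L real)" where
  "dual_eval x = Blinfun (\<lambda>y. blinfun_apply y x)"

lemma dual_eval_apply [simp]: "blinfun_apply (dual_eval x) y = blinfun_apply y x"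
  by (simp add: dual_eval_def bounded_linear_Blinfun_apply blinfun.bounded_linear_left)

lemma reflexive_imp_dual_eval:
  fixes F :: "('a::real_normed_vector \<Rightarrow>\<^sub>L real) \<Rightarrow>\<^sub>L real"
  assumes "reflexive_space TYPE('a)"
  obtains x where "F = dual_eval x"
  using assms by (metis reflexive_space_def dual_eval_apply blinfun_eqI)

lemma dual_eval_bounded_linear: "bounded_linear dual_eval"
proof (rule bounded_linear_intro[where K = 1])
  show "dual_eval (x + y) = dual_eval x + dual_eval y" for x y :: 'a
    by (rule blinfun_eqI) (simp add: blinfun.add_left blinfun.add_right)
  show "dual_eval (c *\<^sub>R x) = c *\<^sub>R dual_eval x" for c and x :: 'a
    by (rule blinfun_eqI) (simp add: blinfun.scaleR_left blinfun.scaleR_right)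
  show "norm (dual_eval x) \<le> norm x * 1" for x :: 'a
  proof (rule norm_blinfun_bound)
    fix y :: "'a \<Rightarrow>\<^sub>L real"
    show "norm (blinfun_apply (dual_eval x) y) \<le> norm x * 1 * norm y"
      using norm_blinfun[of y x] by (simp add: mult.commute)
  qed simp
qed

text \<open>Every \<open>\<xi>\<close> is some \<open>dual_eval x\<close>, so \<open>F\<close> is
  determined by its pullback along the embedding, and this pullback is an element of the
  dual.\<close>

lemma reflexive_dual:
  assumes "reflexive_space TYPE('a::real_normed_vector)"
  shows "reflexive_space TYPE('a \<Rightarrow>\<^sub>L real)"
  unfolding reflexive_space_def
proof
  fix F :: "(('a \<Rightarrow>\<^sub>L real) \<Rightarrow>\<^sub>L real) \<Rightarrow>\<^sub>L real"
  define y where "y = F o\<^sub>L Blinfun dual_eval"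
  have y: "blinfun_apply y x = blinfun_apply F (dual_eval x)" for x
    by (simp add: y_def bounded_linear_Blinfun_apply dual_eval_bounded_linear)
  have "blinfun_apply F \<xi> = blinfun_apply \<xi> y" for \<xi>
    using reflexive_imp_dual_eval[OF assms, of \<xi>] y by (metis dual_eval_apply)
  then show "\<exists>y. \<forall>\<xi>. blinfun_apply F \<xi> = blinfun_apply \<xi> y" by blast
qed

section \<open>Potentials with bijective derivative, and their conjugates\<close>

text \<open>This class of potentials is closed under conjugation, so that right projections are left
  projections of the conjugate potential on the dual space.\<close>

locale legendre_potential =
  fixes f :: "'a::real_normed_vector \<Rightarrow> real" and G :: "'a \<Rightarrow> ('a \<Rightarrow>\<^sub>L real)"
  assumes reflexive: "reflexive_space TYPE('a)"
    and subgradient: "f x + blinfun_apply (G x) (z - x) \<le> f z"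
    and derivative: "((\<lambda>t. (f (x + t *\<^sub>R h) - f x) / t) \<longlongrightarrow> blinfun_apply (G x) h) (at 0)"
    and strict: "f z = f x + blinfun_apply (G x) (z - x) \<Longrightarrow> z = x"
    and coercive: "\<exists>R. \<forall>x. R \<le> norm x \<longrightarrow> M * norm x \<le> f x"
    and bounded_on_balls: "\<exists>B. \<forall>x. norm x \<le> r \<longrightarrow> f x \<le> B"
begin

text \<open>\<open>f z\<close> is the largest value at \<open>z\<close> of the affine minorants of
  \<open>f\<close>, attained by the one based at \<open>z\<close>. Sublevel sets thus inherit
  closedness and convexity from half-spaces.\<close>

lemma sublevel_eq:
  "{z\<in>K. f z - blinfun_apply q z \<le> c} =
    K \<inter> (\<Inter>x. {z. blinfun_apply (G x - q) z \<le> c - f x + blinfun_apply (G x) x})"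
  (is "?L = ?R")
proof
  show "?L \<subseteq> ?R"
  proof (clarsimp)
    fix z x assume "f z - blinfun_apply q z \<le> c"
    then show "blinfun_apply (G x - q) z \<le> c - f x + blinfun_apply (G x) x"
      using subgradient[of x z] by (simp add: blinfun.diff_left blinfun.diff_right)
  qed
  show "?R \<subseteq> ?L"
    by (auto simp: blinfun.diff_left) (smt (verit))
qed

lemma closed_sublevel: "closed K \<Longrightarrow> closed {z\<in>K. f z - blinfun_apply q z \<le> c}"
  unfolding sublevel_eq
  by (intro closed_Int closed_INT ballI closed_Collect_le continuous_intros)
    auto

lemma convex_sublevel: "convex K \<Longrightarrow> convex {z\<in>K. f z - blinfun_apply q z \<le> c}"
  unfolding sublevel_eq
proof (intro convex_Int convex_INT)
  fix x
  let ?b = "c - f x + blinfun_apply (G x) x"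
  show "convex {z. blinfun_apply (G x - q) z \<le> ?b}"
  proof (rule convexI, clarify)
    fix y z and u v :: real
    assume "blinfun_apply (G x - q) y \<le> ?b" "blinfun_apply (G x - q) z \<le> ?b"
      and uv: "0 \<le> u" "0 \<le> v" "u + v = 1"
    then have "u * blinfun_apply (G x - q) y + v * blinfun_apply (G x - q) z \<le> u * ?b + v * ?b"
      by (intro add_mono mult_left_mono)
    also have "\<dots> = ?b" using uv(3) by (metis distrib_right mult_1)
    finally show "blinfun_apply (G x - q) (u *\<^sub>R y + v *\<^sub>R z) \<le> ?b"
      by (simp only: blinfun.add_right blinfun.scaleR_right real_scaleR_def)
  qed
qed

lemma tilted_coercive:
  obtains R where "\<And>x. R \<le> norm x \<Longrightarrow> norm x \<le> f x - blinfun_apply q x"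
proof -
  \<comment> \<open>The slope \<open>norm q + 1\<close> pays for \<open>q\<close> and leaves
    \<open>norm x\<close>.\<close>
  obtain R where R: "\<And>x. R \<le> norm x \<Longrightarrow> (norm q + 1) * norm x \<le> f x"
    using coercive by metis
  have "norm x \<le> f x - blinfun_apply q x" if "R \<le> norm x" for x
    using R[OF that] norm_blinfun[of q x] by (simp add: algebra_simps)
  with that show ?thesis by blast
qed

text \<open>Coercivity gives the bound outside a ball, the affine minorant at 0 gives it
  inside.\<close>

lemma tilted_bounded_below:
  obtains c where "\<And>x. c \<le> f x - blinfun_apply q x"
proof -
  obtain R where R: "\<And>x. R \<le> norm x \<Longrightarrow> norm x \<le> f x - blinfun_apply q x"
    using tilted_coercive by metis
  have "min 0 (f 0 - norm (G 0 - q) * \<bar>R\<bar>) \<le> f x - blinfun_apply q x" for x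
  proof (cases "R \<le> norm x")
    case True
    then show ?thesis using R[OF True] norm_ge_zero[of x] by linarith
  next
    case False
    have "\<bar>blinfun_apply (G 0 - q) x\<bar> \<le> norm (G 0 - q) * norm x"
      using norm_blinfun[of "G 0 - q" x] by simp
    also have "\<dots> \<le> norm (G 0 - q) * \<bar>R\<bar>"
      using False by (intro mult_left_mono) auto
    finally show ?thesis using subgradient[of 0 x] by (simp add: blinfun.diff_left)
  qed
  with that show ?thesis by blast
qed

lemma minimizer_exists:
  assumes K: "convex K" "closed K" "K \<noteq> {}"
  obtains w where "w \<in> K" and "\<And>y. y \<in> K \<Longrightarrow> f w - blinfun_apply q w \<le> f y - blinfun_apply q y"
proof -
  let ?g = "\<lambda>x. f x - blinfun_apply q x"
  define m where "m = (INF x\<in>K. ?g x)"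
  \<comment> \<open>Levels above the infimum keep the sets nonempty; they tend to \<open>m\<close>,
    so a common point is a minimiser.\<close>
  define C where "C n = {z\<in>K. ?g z \<le> m + 1 / Suc n}" for n
  obtain c where "\<And>x. c \<le> ?g x" using tilted_bounded_below by metis
  then have m_le: "m \<le> ?g x" if "x \<in> K" for x
    unfolding m_def using that by (intro cINF_lower) (auto simp: bdd_below_def)
  obtain R where R: "\<And>x. R \<le> norm x \<Longrightarrow> norm x \<le> ?g x"
    using tilted_coercive by metis
  obtain w where w: "\<And>n. w \<in> C n"
  proof (rule reflexive_nested_intersection[OF reflexive, of C])
    show "convex (C n)" "closed (C n)" for n
      using K by (simp_all add: C_def convex_sublevel closed_sublevel)
    show "C n \<noteq> {}" for n
    proof -
      have "Inf (?g ` K) < m + 1 / Suc n" by (simp add: m_def)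
      then obtain z where "z \<in> K" "?g z < m + 1 / Suc n"
        using cInf_lessD[of "?g ` K"] K(3) by blast
      then show ?thesis by (auto simp: C_def intro: less_imp_le)
    qed
    show "C n \<subseteq> C k" if "k \<le> n" for k n
    proof -
      have "1 / real (Suc n) \<le> 1 / real (Suc k)" using that by (simp add: frac_le)
      then show ?thesis by (auto simp: C_def)
    qed
    show "bounded (C 0)"
      unfolding bounded_iff
    proof (intro exI ballI)
      fix x assume "x \<in> C 0"
      then show "norm x \<le> max R (m + 1)"
        using R[of x] by (cases "R \<le> norm x") (auto simp: C_def)
    qed
  qed blast
  have "?g w \<le> m + e" if e: "0 < e" for e
  proof -
    obtain n where "inverse (real (Suc n)) < e" using reals_Archimedean[OF e] by blast
    with w[of n] show ?thesis by (simp add: C_def inverse_eq_divide)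
  qed
  then have "?g w \<le> m" by (rule field_le_epsilon)
  with m_le w that show ?thesis by (force simp: C_def)
qed

text \<open>Along a segment from a minimiser into \<open>K\<close> the tilted function has
  nonnegative one-sided derivative. The converse is the subgradient inequality at
  \<open>w\<close>.\<close>

lemma minimizer_iff_variational:
  assumes "convex K" "w \<in> K"
  shows "(\<forall>y\<in>K. f w - blinfun_apply q w \<le> f y - blinfun_apply q y) \<longleftrightarrow>
    (\<forall>y\<in>K. 0 \<le> blinfun_apply (q - G w) (w - y))"
proof (intro iffI ballI)
  fix y assume min: "\<forall>y\<in>K. f w - blinfun_apply q w \<le> f y - blinfun_apply q y" and y: "y \<in> K"
  have "blinfun_apply q (y - w) \<le> (f (w + t *\<^sub>R (y - w)) - f w) / t" if "0 < t" "t < 1" for t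
  proof -
    have "(1 - t) *\<^sub>R w + t *\<^sub>R y \<in> K"
      using assms y that by (intro convexD) auto
    also have "(1 - t) *\<^sub>R w + t *\<^sub>R y = w + t *\<^sub>R (y - w)" by (simp add: algebra_simps)
    finally have "f w - blinfun_apply q w \<le> f (w + t *\<^sub>R (y - w)) - blinfun_apply q (w + t *\<^sub>R (y - w))"
      using min by blast
    then have "t * blinfun_apply q (y - w) \<le> f (w + t *\<^sub>R (y - w)) - f w"
      by (simp add: blinfun.add_right blinfun.scaleR_right)
    then show ?thesis using that by (simp add: pos_le_divide_eq mult.commute)
  qed
  then have "\<forall>\<^sub>F t in at_right 0. blinfun_apply q (y - w) \<le> (f (w + t *\<^sub>R (y - w)) - f w) / t"
    unfolding eventually_at_right_field by (intro exI[of _ 1]) auto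
  moreover have "((\<lambda>t. (f (w + t *\<^sub>R (y - w)) - f w) / t) \<longlongrightarrow> blinfun_apply (G w) (y - w)) (at_right 0)"
    using derivative[of w "y - w"] by (rule filterlim_mono) (auto simp: at_le)
  ultimately have "blinfun_apply q (y - w) \<le> blinfun_apply (G w) (y - w)"
    by (intro tendsto_lowerbound) auto
  then show "0 \<le> blinfun_apply (q - G w) (w - y)"
    by (simp add: blinfun.diff_left blinfun.diff_right)
next
  fix y assume "\<forall>y\<in>K. 0 \<le> blinfun_apply (q - G w) (w - y)" and "y \<in> K"
  then have "0 \<le> blinfun_apply (q - G w) (w - y)" by blast
  then show "f w - blinfun_apply q w \<le> f y - blinfun_apply q y"
    using subgradient[of w y] by (simp add: blinfun.diff_left blinfun.diff_right)
qed

text \<open>Adding the assumptions cancels \<open>q\<close> and leaves the reverse of the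
  monotonicity of \<open>G\<close>. So the subgradient inequalities between \<open>z\<close> and
  \<open>z'\<close> are equalities, and \<open>strict\<close> applies.\<close>

lemma variational_unique:
  assumes "0 \<le> blinfun_apply (q - G z) (z - z')" "0 \<le> blinfun_apply (q - G z') (z' - z)"
  shows "z = z'"
proof -
  have "f z' = f z + blinfun_apply (G z) (z' - z)"
    using assms subgradient[of z z'] subgradient[of z' z]
    by (simp add: blinfun.diff_left blinfun.diff_right)
  then show ?thesis by (metis strict)
qed

text \<open>For surjectivity, a minimiser of \<open>f\<close> minus \<open>q\<close> over the whole
  space satisfies the variational inequality in the directions \<open>h\<close> and
  \<open>- h\<close>, so its derivative is \<open>q\<close>. Injectivity comes from
  \<open>strict\<close>.\<close>

lemma bij_G: "bij G"
proof (rule bijI)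
  show "inj G"
  proof (rule injI)
    fix x y assume "G x = G y"
    then have "f y = f x + blinfun_apply (G x) (y - x)"
      using subgradient[of x y] subgradient[of y x] by (simp add: blinfun.diff_right)
    then show "x = y" by (metis strict)
  qed
  have "\<exists>w. q = G w" for q
  proof -
    obtain w where "\<And>y. f w - blinfun_apply q w \<le> f y - blinfun_apply q y"
      using minimizer_exists[of UNIV q] by auto
    then have vi: "0 \<le> blinfun_apply (q - G w) (w - y)" for y
      using minimizer_iff_variational[of UNIV w q] by auto
    have "blinfun_apply (q - G w) h = 0" for h
      using vi[of "w - h"] vi[of "w + h"] by (simp add: blinfun.minus_right)
    then have "q - G w = 0" by (intro blinfun_eqI) simp
    then show ?thesis by auto
  qed
  then show "surj G" by (auto simp: surj_def)
qed

lemma G_inv [simp]: "G (inv G q) = q"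
  using bij_G by (simp add: bij_is_surj surj_f_inv_f)

lemma inv_G [simp]: "inv G (G x) = x"
  using bij_G by (simp add: bij_is_inj)

text \<open>The supremum in the convex conjugate is attained at \<open>inv G q\<close>, so this is
  its real value; see \<open>convex_conjugate_eq\<close>.\<close>

definition conjugate :: "('a \<Rightarrow>\<^sub>L real) \<Rightarrow> real" where
  "conjugate q = blinfun_apply q (inv G q) - f (inv G q)"

definition conjugate_deriv :: "('a \<Rightarrow>\<^sub>L real) \<Rightarrow> (('a \<Rightarrow>\<^sub>L real) \<Rightarrow>\<^sub>L real)" where
  "conjugate_deriv q = dual_eval (inv G q)"

lemma fenchel_young: "blinfun_apply q x - f x \<le> conjugate q"
  using subgradient[of "inv G q" x] by (simp add: conjugate_def blinfun.diff_right)

lemma fenchel_young_eq: "blinfun_apply q x - f x = conjugate q \<Longrightarrow> G x = q"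
  using strict[of x "inv G q"] by (simp add: conjugate_def blinfun.diff_right)

lemma conjugate_G: "conjugate (G x) = blinfun_apply (G x) x - f x"
  by (simp add: conjugate_def)

lemma conjugate_subgradient:
  "conjugate q + blinfun_apply (conjugate_deriv q) (r - q) \<le> conjugate r"
  using fenchel_young[of r "inv G q"]
  by (simp add: conjugate_deriv_def conjugate_def blinfun.diff_left)

text \<open>If \<open>inv G q\<close> is far out, coercivity of \<open>f\<close> with slope
  \<open>\<bar>r\<bar>\<close> makes the value at most 0. Otherwise its norm is bounded and the
  lower bound of \<open>f\<close> applies.\<close>

lemma conjugate_bounded_on_balls: "\<exists>B. \<forall>q. norm q \<le> r \<longrightarrow> conjugate q \<le> B"
proof -
  obtain R where R: "\<And>x. R \<le> norm x \<Longrightarrow> \<bar>r\<bar> * norm x \<le> f x"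
    using coercive by metis
  obtain c where c: "\<And>x. c \<le> f x"
    using tilted_bounded_below[of 0] by auto
  have "conjugate q \<le> max 0 (\<bar>r\<bar> * \<bar>R\<bar> - c)" if "norm q \<le> r" for q
  proof -
    let ?x = "inv G q"
    have "norm q * norm ?x \<le> \<bar>r\<bar> * norm ?x"
      using that by (intro mult_right_mono) auto
    then have q: "blinfun_apply q ?x \<le> \<bar>r\<bar> * norm ?x"
      using norm_blinfun[of q ?x] by (simp add: abs_le_iff)
    show ?thesis
    proof (cases "R \<le> norm ?x")
      case True
      then show ?thesis using R[OF True] q by (simp add: conjugate_def)
    next
      case False
      then have "\<bar>r\<bar> * norm ?x \<le> \<bar>r\<bar> * \<bar>R\<bar>" by (intro mult_left_mono) auto
      then show ?thesis using c[of ?x] q by (simp add: conjugate_def)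
    qed
  qed
  then show ?thesis by blast
qed

text \<open>Fenchel-Young at points of norm \<open>r\<close>, where \<open>f\<close> is at most
  \<open>B\<close>, gives \<open>r * norm q \<le> conjugate q + B\<close>. As \<open>r\<close> is at
  least \<open>M + 1\<close>, a surplus \<open>norm q\<close> remains to absorb
  \<open>B\<close>.\<close>

lemma conjugate_coercive: "\<exists>R. \<forall>q. R \<le> norm q \<longrightarrow> M * norm q \<le> conjugate q"
proof -
  define r where "r = \<bar>M\<bar> + 1"
  have r: "0 < r" by (simp add: r_def)
  obtain B where B: "\<And>x. norm x \<le> r \<Longrightarrow> f x \<le> B" using bounded_on_balls by metis
  have le: "r * norm q \<le> conjugate q + B" for q
  proof -
    have abs_le: "\<bar>blinfun_apply q x\<bar> \<le> (conjugate q + B) / r * norm x" for x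
    proof (cases "x = 0")
      case False
      have le: "blinfun_apply q x \<le> (conjugate q + B) / r * norm x" if "x \<noteq> 0" for x
      proof -
        have "blinfun_apply q ((r / norm x) *\<^sub>R x) \<le> conjugate q + B"
          using fenchel_young[of q "(r / norm x) *\<^sub>R x"] B[of "(r / norm x) *\<^sub>R x"] that r by simp
        then show ?thesis using that r by (simp add: blinfun.scaleR_right field_simps)
      qed
      show ?thesis using le[OF False] le[of "- x"] False by (simp add: blinfun.minus_right abs_le_iff)
    qed simp
    have "0 \<le> conjugate q + B"
      using fenchel_young[of q 0] B[of 0] r by simp
    then have "norm q \<le> (conjugate q + B) / r"
      using abs_le r by (intro norm_blinfun_bound) auto
    then show ?thesis using r by (simp add: pos_le_divide_eq mult.commute)
  qed
  have "M * norm q \<le> conjugate q" if "B \<le> norm q" for q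
  proof -
    have "(M + 1) * norm q \<le> r * norm q" by (intro mult_right_mono) (auto simp: r_def)
    then show ?thesis using le[of q] that by (simp add: distrib_right)
  qed
  then show ?thesis by blast
qed

text \<open>A subgradient of the conjugate is evaluation at some \<open>x\<close> by reflexivity, and equality
  in the Fenchel-Young inequality determines \<open>x\<close>.\<close>

lemma conjugate_derivative:
  "((\<lambda>t. (conjugate (q + t *\<^sub>R h) - conjugate q) / t) \<longlongrightarrow> blinfun_apply (conjugate_deriv q) h) (at 0)"
proof -
  obtain B where B: "\<And>k. norm k \<le> norm q + 1 \<Longrightarrow> conjugate k \<le> B"
    using conjugate_bounded_on_balls by metis
  show ?thesis
  proof (rule derivative_if_unique_subgradient[where B = B])
    show "convex_on UNIV conjugate"
      using conjugate_subgradient by (rule convex_on_if_subgradients)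
    show "conjugate (q + k) \<le> B" if "norm k \<le> 1" for k
      using that norm_triangle_ineq[of q k] by (intro B) simp
    fix y assume y: "\<And>k. blinfun_apply y k \<le> conjugate (q + k) - conjugate q"
    obtain x where x: "y = dual_eval x" using reflexive_imp_dual_eval[OF reflexive] by metis
    have "conjugate q \<le> blinfun_apply q x - f x"
      using y[of "G x - q"] by (simp add: x conjugate_G blinfun.diff_left)
    then have "G x = q" using fenchel_young[of q x] by (intro fenchel_young_eq) simp
    then show "y = conjugate_deriv q" by (auto simp: x conjugate_deriv_def)
  qed
qed

lemma legendre_potential_conjugate: "legendre_potential conjugate conjugate_deriv"
proof
  show "reflexive_space TYPE('a \<Rightarrow>\<^sub>L real)" by (rule reflexive_dual[OF reflexive])
  \<comment> \<open>The equality says that Fenchel-Young is sharp for \<open>r\<close> at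
    \<open>inv G q\<close>, hence \<open>G (inv G q) = r\<close>.\<close>
  show "r = q" if "conjugate r = conjugate q + blinfun_apply (conjugate_deriv q) (r - q)" for q r
  proof -
    have "blinfun_apply r (inv G q) - f (inv G q) = conjugate r"
      using that by (simp add: conjugate_deriv_def conjugate_def blinfun.diff_left)
    from fenchel_young_eq[OF this] show ?thesis by simp
  qed
qed (fact conjugate_subgradient conjugate_derivative conjugate_coercive conjugate_bounded_on_balls)+

end

section \<open>Left and right projections of a potential\<close>

text \<open>\<open>arg_min_on\<close> is a choice, pinned down here by uniqueness. \<open>P\<close>
  stands for the variational inequality of either projection.\<close>

lemma arg_min_on_characterization:
  fixes d :: "'a \<Rightarrow> 'b::linorder"
  assumes ex: "\<exists>w\<in>K. \<forall>y\<in>K. d w \<le> d y"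
    and iff: "\<And>z. z \<in> K \<Longrightarrow> (\<forall>y\<in>K. d z \<le> d y) \<longleftrightarrow> P z"
    and unique: "\<And>z z'. z \<in> K \<Longrightarrow> z' \<in> K \<Longrightarrow> P z \<Longrightarrow> P z' \<Longrightarrow> z = z'"
  shows "\<exists>!x. is_arg_min d (\<lambda>x. x \<in> K) x"
    and "\<And>w. w \<in> K \<Longrightarrow> w = arg_min_on d K \<longleftrightarrow> is_the_unique w K P"
proof -
  have arg_min: "is_arg_min d (\<lambda>x. x \<in> K) z \<longleftrightarrow> z \<in> K \<and> P z" for z
    using iff[of z] by (auto simp: is_arg_min_def not_less)
  obtain w where w: "w \<in> K" "P w" using ex iff by blast
  then show "\<exists>!x. is_arg_min d (\<lambda>x. x \<in> K) x"
    using unique by (auto simp: arg_min)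
  have "arg_min_on d K = w"
    unfolding arg_min_on_def arg_min_def using w unique by (intro some_equality) (auto simp: arg_min)
  then show "w' = arg_min_on d K \<longleftrightarrow> is_the_unique w' K P" if "w' \<in> K" for w'
    using w unique that by (auto simp: is_the_unique_def)
qed

lemma has_gateaux_derivative_ereal_iff:
  "has_gateaux_derivative (\<lambda>x. ereal (f x)) g x \<longleftrightarrow>
    (\<forall>h. ((\<lambda>t. (f (x + t *\<^sub>R h) - f x) / t) \<longlongrightarrow> blinfun_apply g h) (at 0))"
proof -
  have "((\<lambda>t. (ereal (f (x + t *\<^sub>R h)) - ereal (f x)) / ereal t) \<longlongrightarrow> ereal (blinfun_apply g h)) (at 0)
      \<longleftrightarrow> ((\<lambda>t. ereal ((f (x + t *\<^sub>R h) - f x) / t)) \<longlongrightarrow> ereal (blinfun_apply g h)) (at 0)" for h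
    \<comment> \<open>The quotients agree for \<open>t \<noteq> 0\<close>, and \<open>at 0\<close>
      ignores the value at 0.\<close>
    by (rule tendsto_cong) (simp add: eventually_at_filter)
  then show ?thesis by (simp add: has_gateaux_derivative_def)
qed

context legendre_potential
begin

abbreviation \<Psi> :: "'a \<Rightarrow> ereal" where
  "\<Psi> x \<equiv> ereal (f x)"

definition real_bregman :: "'a \<Rightarrow> 'a \<Rightarrow> real" where
  "real_bregman x y = f x - f y - blinfun_apply (G y) (x - y)"

lemma has_gateaux_derivative_iff: "has_gateaux_derivative \<Psi> g x \<longleftrightarrow> g = G x"
proof
  assume "has_gateaux_derivative \<Psi> g x"
  then have "blinfun_apply g h = blinfun_apply (G x) h" for h
    using derivative[of x h] by (intro tendsto_unique[of "at 0"]) (auto simp: has_gateaux_derivative_ereal_iff)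
  then show "g = G x" by (rule blinfun_eqI)
qed (simp add: has_gateaux_derivative_ereal_iff derivative)

lemma gateaux_deriv_eq [simp]: "gateaux_deriv \<Psi> = G"
  by (auto simp: gateaux_deriv_def has_gateaux_derivative_iff)

lemma bregman_eq [simp]: "bregman \<Psi> x y = ereal (real_bregman x y)"
  by (simp add: bregman_def gateaux_differentiable_at_def has_gateaux_derivative_iff real_bregman_def)

lemma effective_domain_eq [simp]: "effective_domain \<Psi> = UNIV"
  by (simp add: effective_domain_def)

lemma convex_conjugate_eq: "convex_conjugate \<Psi> = (\<lambda>q. ereal (conjugate q))"
proof
  fix q
  show "convex_conjugate \<Psi> q = ereal (conjugate q)"
    unfolding convex_conjugate_def
  proof (rule antisym)
    show "(SUP x. ereal (blinfun_apply q x) - \<Psi> x) \<le> ereal (conjugate q)"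
      by (rule SUP_least) (simp add: fenchel_young)
    show "ereal (conjugate q) \<le> (SUP x. ereal (blinfun_apply q x) - \<Psi> x)"
      by (rule SUP_upper2[of "inv G q"]) (auto simp: conjugate_def)
  qed
qed

lemma real_bregman_eq_0_iff: "real_bregman x y = 0 \<longleftrightarrow> x = y"
  using strict[of x y] by (auto simp: real_bregman_def)

lemma information: "is_information_on (bregman \<Psi>) UNIV"
  by (simp add: is_information_on_def zero_ereal_def real_bregman_eq_0_iff)

text \<open>The identity behind it is that
  \<open>real_bregman y x - real_bregman y z - real_bregman z x\<close> equals
  \<open>blinfun_apply (G x - G z) (z - y)\<close>.\<close>

lemma three_point:
  "real_bregman y z + real_bregman z x \<le> real_bregman y x \<longleftrightarrow> 0 \<le> blinfun_apply (G x - G z) (z - y)"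
  by (simp add: real_bregman_def blinfun.diff_left blinfun.diff_right) linarith

lemma left_minimizer:
  assumes K: "convex K" "closed K" "K \<noteq> {}"
  shows "\<exists>w\<in>K. \<forall>y\<in>K. real_bregman w x \<le> real_bregman y x"
    and "z \<in> K \<Longrightarrow> (\<forall>y\<in>K. real_bregman z x \<le> real_bregman y x) \<longleftrightarrow>
      (\<forall>y\<in>K. 0 \<le> blinfun_apply (G x - G z) (z - y))"
proof -
  \<comment> \<open>Terms in \<open>x\<close> alone cancel, which leaves \<open>f\<close> tilted by
    \<open>G x\<close>.\<close>
  have le: "real_bregman w x \<le> real_bregman y x \<longleftrightarrow>
      f w - blinfun_apply (G x) w \<le> f y - blinfun_apply (G x) y" for w y
    by (simp add: real_bregman_def blinfun.diff_right)
  show "\<exists>w\<in>K. \<forall>y\<in>K. real_bregman w x \<le> real_bregman y x"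
    using minimizer_exists[OF K, of "G x"] unfolding le by metis
  show "(\<forall>y\<in>K. real_bregman z x \<le> real_bregman y x) \<longleftrightarrow>
      (\<forall>y\<in>K. 0 \<le> blinfun_apply (G x - G z) (z - y))" if "z \<in> K"
    unfolding le using that K by (intro minimizer_iff_variational)
qed

lemma left_chebyshev_pythagorean:
  assumes K: "convex K" "closed K" "K \<noteq> {}"
  shows "left_chebyshev \<Psi> K" and "left_pythagorean \<Psi> K"
proof -
  have vi: "\<exists>!w. is_arg_min (\<lambda>w. bregman \<Psi> w x) (\<lambda>w. w \<in> K) w"
      "\<And>w. w \<in> K \<Longrightarrow> w = left_projection \<Psi> K x \<longleftrightarrow>
        is_the_unique w K (\<lambda>z. \<forall>y\<in>K. 0 \<le> blinfun_apply (G x - G z) (z - y))" for x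
    unfolding left_projection_def
    using arg_min_on_characterization[of K "\<lambda>w. bregman \<Psi> w x"
        "\<lambda>z. \<forall>y\<in>K. 0 \<le> blinfun_apply (G x - G z) (z - y)"] left_minimizer[OF K] variational_unique[of "G x"]
    by simp_all
  from vi(1) show cheb: "left_chebyshev \<Psi> K" by (simp add: left_chebyshev_def)
  with vi(2) show "left_pythagorean \<Psi> K"
    by (simp add: left_pythagorean_def three_point)
qed

text \<open>Fenchel-Young is an equality at \<open>x\<close> with \<open>G x\<close> and at
  \<open>y\<close> with \<open>G y\<close>. The exchange of arguments is what turns right
  projections into left ones.\<close>

lemma real_bregman_conjugate:
  "legendre_potential.real_bregman conjugate conjugate_deriv (G y) (G x) = real_bregman x y"
proof -
  interpret dual: legendre_potential conjugate conjugate_deriv by (rule legendre_potential_conjugate)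
  show ?thesis
    by (simp add: dual.real_bregman_def real_bregman_def conjugate_G conjugate_deriv_def
        blinfun.diff_left blinfun.diff_right)
qed

text \<open>Minimising over the second argument in \<open>K\<close> is minimising the dual
  divergence over its first argument in the image of \<open>K\<close> under \<open>G\<close>.
  Injectivity of \<open>G\<close> carries uniqueness back to \<open>K\<close>.\<close>

lemma right_chebyshev_pythagorean:
  assumes K: "convex (G ` K)" "closed (G ` K)" "K \<noteq> {}"
  shows "right_chebyshev \<Psi> K" and "right_pythagorean \<Psi> K"
proof -
  interpret dual: legendre_potential conjugate conjugate_deriv by (rule legendre_potential_conjugate)
  have K': "G ` K \<noteq> {}" using K(3) by simp
  have ex: "\<exists>w\<in>K. \<forall>y\<in>K. bregman \<Psi> x w \<le> bregman \<Psi> x y" for x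
    using dual.left_minimizer(1)[OF K(1,2) K', of "G x"] by (simp add: real_bregman_conjugate)
  have swap: "blinfun_apply (conjugate_deriv (G x) - conjugate_deriv (G z)) (G z - G y) =
      blinfun_apply (G z - G y) (x - z)" for x y z
    by (simp add: conjugate_deriv_def blinfun.diff_left blinfun.diff_right)
  have iff: "(\<forall>y\<in>K. bregman \<Psi> x z \<le> bregman \<Psi> x y) \<longleftrightarrow>
      (\<forall>y\<in>K. 0 \<le> blinfun_apply (G z - G y) (x - z))" if "z \<in> K" for x z
    using dual.left_minimizer(2)[OF K(1,2) K', where z = "G z" and x = "G x"] that
    by (simp add: real_bregman_conjugate swap)
  have unique: "z = z'"
    if "z \<in> K" "z' \<in> K" "\<forall>y\<in>K. 0 \<le> blinfun_apply (G z - G y) (x - z)"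
      "\<forall>y\<in>K. 0 \<le> blinfun_apply (G z' - G y) (x - z')" for x z z'
  proof -
    have "G z = G z'"
      using that by (intro dual.variational_unique[of "conjugate_deriv (G x)"]) (simp_all add: swap)
    then show ?thesis by (metis inv_G)
  qed
  have "\<exists>!w. is_arg_min (\<lambda>w. bregman \<Psi> x w) (\<lambda>w. w \<in> K) w" for x
    by (rule arg_min_on_characterization(1)[OF ex iff[where x = x] unique[where x = x]])
  then show cheb: "right_chebyshev \<Psi> K" by (simp add: right_chebyshev_def)
  have vi: "w = right_projection \<Psi> K x \<longleftrightarrow>
      is_the_unique w K (\<lambda>z. \<forall>y\<in>K. 0 \<le> blinfun_apply (G z - G y) (x - z))" if "w \<in> K" for w x
    unfolding right_projection_def using that
    by (rule arg_min_on_characterization(2)[OF ex iff[where x = x] unique[where x = x], rotated -1])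
  \<comment> \<open>The three-point identity with the roles exchanged and both signs
    flipped.\<close>
  have "real_bregman x z + real_bregman z y \<le> real_bregman x y \<longleftrightarrow>
      0 \<le> blinfun_apply (G z - G y) (x - z)" for x y z
    by (simp add: real_bregman_def blinfun.diff_left blinfun.diff_right) linarith
  with vi cheb show "right_pythagorean \<Psi> K"
    by (simp add: right_pythagorean_def)
qed

text \<open>The potential is finite everywhere, so the interior of its domain is the whole
  space.\<close>

lemma zone_consistent_trivial: "zone_consistent \<Psi> P"
  by (simp add: zone_consistent_def)

end

section \<open>The potential of a gauge\<close>

text \<open>\<open>\<phi>\<close> is increasing, so between \<open>s\<close> and \<open>t\<close> it
  stays on one side of \<open>\<phi> s\<close>.\<close>

lemma gauge_primitive_subgradient:
  assumes \<phi>: "gauge_function \<phi>" and s: "0 \<le> s" and t: "0 \<le> t"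
  shows "integral {0..s} \<phi> + \<phi> s * (t - s) \<le> integral {0..t} \<phi>"
proof -
  have mono: "\<phi> a \<le> \<phi> b" if "0 \<le> a" "a \<le> b" for a b
    using \<phi> that unfolding gauge_function_def
    by (metis atLeast_iff less_eq_real_def order_trans strict_mono_onD)
  have int: "\<phi> integrable_on {a..b}" if "0 \<le> a" for a b
    using \<phi> that unfolding gauge_function_def
    by (intro integrable_continuous_interval) (auto elim!: continuous_on_subset)
  consider "s \<le> t" | "t \<le> s" by linarith
  then show ?thesis
  proof cases
    case 1
    have "integral {s..t} (\<lambda>_. \<phi> s) \<le> integral {s..t} \<phi>"
      using s mono by (intro integral_le int) auto
    moreover have "integral {0..s} \<phi> + integral {s..t} \<phi> = integral {0..t} \<phi>"
      using s 1 int by (intro Henstock_Kurzweil_Integration.integral_combine) auto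
    ultimately show ?thesis using 1 by (simp add: mult.commute)
  next
    case 2
    have "integral {t..s} \<phi> \<le> integral {t..s} (\<lambda>_. \<phi> s)"
      using t mono by (intro integral_le int) auto
    moreover have "integral {0..t} \<phi> + integral {t..s} \<phi> = integral {0..s} \<phi>"
      using t 2 int by (intro Henstock_Kurzweil_Integration.integral_combine) auto
    ultimately show ?thesis using 2 by (simp add: algebra_simps)
  qed
qed

lemma gauge_primitive_strict:
  assumes \<phi>: "gauge_function \<phi>" and s: "0 \<le> s" and t: "0 \<le> t" and "s \<noteq> t"
  shows "integral {0..s} \<phi> + \<phi> s * (t - s) < integral {0..t} \<phi>"
proof -
  \<comment> \<open>The inequalities from \<open>s\<close> to the midpoint and from there to
    \<open>t\<close> together beat the direct one by
    \<open>(\<phi> m - \<phi> s) * (t - m)\<close>.\<close>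
  define m where "m = (s + t) / 2"
  have m: "0 \<le> m" using s t by (simp add: m_def)
  have mono: "strict_mono_on {0..} \<phi>" using \<phi> by (simp add: gauge_function_def)
  have "0 < (\<phi> m - \<phi> s) * (t - m)"
  proof (cases "s < t")
    case True
    then have "s < m" "m < t" by (simp_all add: m_def)
    with strict_mono_onD[OF mono, of s m] s m show ?thesis by simp
  next
    case False
    with \<open>s \<noteq> t\<close> have "m < s" "t < m" by (simp_all add: m_def)
    with strict_mono_onD[OF mono, of m s] s m show ?thesis by (simp add: mult_neg_neg)
  qed
  moreover have "(\<phi> m - \<phi> s) * (t - m) = \<phi> m * (t - m) + \<phi> s * (m - s) - \<phi> s * (t - s)"
    by (simp add: algebra_simps)
  ultimately show ?thesis
    using gauge_primitive_subgradient[OF \<phi> s m] gauge_primitive_subgradient[OF \<phi> m t] by linarith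
qed

text \<open>Difference quotients of the norm are monotone, so the derivative lies below the quotient
  at \<open>t = 1\<close>. The direction \<open>- x\<close> then gives the value at
  \<open>x\<close>, and the triangle inequality the bound on \<open>norm g\<close>.\<close>

lemma norm_gateaux_derivative_exists:
  fixes x :: "'a::real_normed_vector"
  assumes "gateaux_differentiable_space TYPE('a)" and "x \<noteq> 0"
  obtains g :: "'a \<Rightarrow>\<^sub>L real"
  where "\<And>h. ((\<lambda>t. (norm (x + t *\<^sub>R h) - norm x) / t) \<longlongrightarrow> blinfun_apply g h) (at 0)"
    and "\<And>h. blinfun_apply g h \<le> norm (x + h) - norm x"
    and "blinfun_apply g x = norm x"
    and "norm g = 1"
proof -
  obtain g :: "'a \<Rightarrow>\<^sub>L real"
    where g: "\<And>h. ((\<lambda>t. (norm (x + t *\<^sub>R h) - norm x) / t) \<longlongrightarrow> blinfun_apply g h) (at 0)"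
    using assms has_gateaux_derivative_ereal_iff[of norm]
    unfolding gateaux_differentiable_space_def gateaux_differentiable_at_def by blast
  have norm_convex: "convex_on UNIV (norm :: 'a \<Rightarrow> real)"
    using convex_on_dist[of UNIV "0 :: 'a"] by simp
  have le: "blinfun_apply g h \<le> norm (x + h) - norm x" for h
  proof -
    have "((\<lambda>t. (norm (x + t *\<^sub>R h) - norm x) / t) \<longlongrightarrow> blinfun_apply g h) (at_right 0)"
      using g[of h] by (rule filterlim_mono) (auto simp: at_le)
    moreover have "(norm (x + t *\<^sub>R h) - norm x) / t \<le> (norm (x + 1 *\<^sub>R h) - norm x) / 1"
      if "0 < t" "t < 1" for t
      using that by (intro convex_diff_quotient_mono norm_convex) auto
    then have "\<forall>\<^sub>F t in at_right 0. (norm (x + t *\<^sub>R h) - norm x) / t \<le> norm (x + h) - norm x"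
      unfolding eventually_at_right_field by (intro exI[of _ 1]) auto
    ultimately show ?thesis by (intro tendsto_upperbound) auto
  qed
  have le_norm: "blinfun_apply g h \<le> norm h" for h
    using le[of h] norm_triangle_ineq[of x h] by linarith
  have gx: "blinfun_apply g x = norm x"
    using le[of "- x"] le_norm[of x] by (simp add: blinfun.minus_right)
  have "norm g \<le> 1"
    using le_norm le_norm[of "- _"] by (intro norm_blinfun_bound) (auto simp: blinfun.minus_right abs_le_iff)
  moreover have "1 \<le> norm g"
    using norm_blinfun[of g x] gx \<open>x \<noteq> 0\<close> by simp
  ultimately have "norm g = 1" by simp
  with g le gx show ?thesis by (rule that)
qed

text \<open>Otherwise the midpoint of the normalised vectors has norm below 1, while
  \<open>g\<close> takes the value 1 there.\<close>

lemma strictly_convex_norming_eq: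
  fixes g :: "'a::real_normed_vector \<Rightarrow>\<^sub>L real"
  assumes strict: "strictly_convex_space TYPE('a)" and x: "x \<noteq> 0" and z: "norm z = norm x"
    and g: "norm g \<le> 1" "blinfun_apply g x = norm x" "blinfun_apply g z = norm x"
  shows "z = x"
proof (rule ccontr)
  assume "z \<noteq> x"
  let ?n = "norm x"
  have "norm ((1/2) *\<^sub>R (x /\<^sub>R ?n) + (1 - 1/2) *\<^sub>R (z /\<^sub>R ?n)) < 1"
    using \<open>z \<noteq> x\<close> x z by (intro strict[unfolded strictly_convex_space_def, rule_format]) auto
  moreover have "blinfun_apply g ((1/2) *\<^sub>R (x /\<^sub>R ?n) + (1 - 1/2) *\<^sub>R (z /\<^sub>R ?n)) = 1"
    using g x by (simp add: blinfun.add_right blinfun.scaleR_right)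
  moreover have "blinfun_apply g v \<le> norm v" for v
    using norm_blinfun[of g v] mult_right_mono[OF g(1) norm_ge_zero[of v]] by simp
  ultimately show False by (metis not_le)
qed

lemma legendre_potential_gauge:
  fixes \<phi> :: "real \<Rightarrow> real"
  assumes \<phi>: "gauge_function \<phi>"
    and refl: "reflexive_space TYPE('a::real_normed_vector)"
    and strict: "strictly_convex_space TYPE('a::real_normed_vector)"
    and smooth: "gateaux_differentiable_space TYPE('a::real_normed_vector)"
  obtains G :: "'a::real_normed_vector \<Rightarrow> ('a \<Rightarrow>\<^sub>L real)"
  where "legendre_potential (\<lambda>x. integral {0..norm x} \<phi>) G" and "\<And>x. duality_map \<phi> x = {G x}"
proof -
  have \<phi>0: "\<phi> 0 = 0" and cont: "continuous_on {0..} \<phi>" and lim: "filterlim \<phi> at_top at_top"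
    using \<phi> by (auto simp: gauge_function_def)
  have pos: "0 < \<phi> s" if "0 < s" for s
    using \<phi> that unfolding gauge_function_def by (metis atLeast_iff less_eq_real_def order_refl strict_mono_onD)
  have nonneg: "0 \<le> \<phi> s" if "0 \<le> s" for s
    using pos[of s] \<phi>0 that by (cases "s = 0") auto
  define f where "f x = integral {0..norm x} \<phi>" for x :: 'a
  have f_sub: "f x + \<phi> (norm x) * (norm z - norm x) \<le> f z" for x z
    unfolding f_def by (rule gauge_primitive_subgradient[OF \<phi>]) auto
  have f0: "f 0 = 0" by (simp add: f_def)
  define Q where "Q x g \<longleftrightarrow>
      (\<forall>h. ((\<lambda>t. (norm (x + t *\<^sub>R h) - norm x) / t) \<longlongrightarrow> blinfun_apply g h) (at 0)) \<and>
      (\<forall>h. blinfun_apply g h \<le> norm (x + h) - norm x) \<and> blinfun_apply g x = norm x \<and> norm g = 1"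
    for x :: 'a and g
  \<comment> \<open>\<open>N 0\<close> is unspecified; the factor \<open>\<phi> 0 = 0\<close> in
    \<open>G\<close> cancels it.\<close>
  define N where "N x = (SOME g. Q x g)" for x
  have Q: "Q x (N x)" if "x \<noteq> 0" for x
    unfolding N_def
    by (rule someI_ex, rule norm_gateaux_derivative_exists[OF smooth that]) (auto simp: Q_def)
  have N_deriv: "((\<lambda>t. (norm (x + t *\<^sub>R h) - norm x) / t) \<longlongrightarrow> blinfun_apply (N x) h) (at 0)"
    and N_le: "blinfun_apply (N x) h \<le> norm (x + h) - norm x"
    and N_self: "blinfun_apply (N x) x = norm x"
    and N_norm: "norm (N x) = 1" if "x \<noteq> 0" for x h
    using Q[OF that] by (simp_all add: Q_def)
  define G where "G x = \<phi> (norm x) *\<^sub>R N x" for x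
  have G0: "G 0 = 0" by (simp add: G_def \<phi>0)
  have G_le: "blinfun_apply (G x) h \<le> \<phi> (norm x) * (norm (x + h) - norm x)" for x h
    using N_le[of x h] nonneg[of "norm x"]
    by (cases "x = 0") (auto simp: G_def \<phi>0 blinfun.scaleR_left intro: mult_left_mono)
  have G_self: "blinfun_apply (G x) x = \<phi> (norm x) * norm x" for x
    by (cases "x = 0") (auto simp: G_def N_self blinfun.scaleR_left)
  have G_norm: "norm (G x) = \<phi> (norm x)" for x
    using nonneg[of "norm x"] by (cases "x = 0") (auto simp: G_def N_norm \<phi>0)
  have G_sub: "f x + blinfun_apply (G x) (z - x) \<le> f z" for x z
    using f_sub[of x z] G_le[of x "z - x"] by simp
  have G_deriv: "((\<lambda>t. (f (x + t *\<^sub>R h) - f x) / t) \<longlongrightarrow> blinfun_apply (G x) h) (at 0)" for x h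
  proof -
    let ?d = "\<lambda>t. norm (x + t *\<^sub>R h) - norm x"
    \<comment> \<open>The error of linearising the primitive at \<open>norm x\<close>, divided by
      \<open>t\<close>. Subgradient inequalities at both points bound it by a term that vanishes by
      continuity of \<open>\<phi>\<close>.\<close>
    let ?e = "\<lambda>t. (f (x + t *\<^sub>R h) - f x) / t - \<phi> (norm x) * (?d t / t)"
    have main: "((\<lambda>t. \<phi> (norm x) * (?d t / t)) \<longlongrightarrow> blinfun_apply (G x) h) (at 0)"
    proof (cases "x = 0")
      case True
      then show ?thesis by (simp add: \<phi>0 G_def)
    next
      case False
      then show ?thesis unfolding G_def blinfun.scaleR_left real_scaleR_def
        by (intro tendsto_intros N_deriv)
    qed
    have "((\<lambda>t. norm (x + t *\<^sub>R h)) \<longlongrightarrow> norm (x + 0 *\<^sub>R h)) (at 0)"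
      by (intro tendsto_intros)
    then have "((\<lambda>t. \<phi> (norm (x + t *\<^sub>R h))) \<longlongrightarrow> \<phi> (norm x)) (at 0)"
      by (intro continuous_on_tendsto_compose[OF cont]) auto
    then have "((\<lambda>t. \<bar>\<phi> (norm (x + t *\<^sub>R h)) - \<phi> (norm x)\<bar> * norm h) \<longlongrightarrow> \<bar>\<phi> (norm x) - \<phi> (norm x)\<bar> * norm h) (at 0)"
      by (intro tendsto_intros)
    then have zero: "((\<lambda>t. \<bar>\<phi> (norm (x + t *\<^sub>R h)) - \<phi> (norm x)\<bar> * norm h) \<longlongrightarrow> 0) (at 0)"
      by simp
    have "\<bar>?e t\<bar> \<le> \<bar>\<phi> (norm (x + t *\<^sub>R h)) - \<phi> (norm x)\<bar> * norm h" if "t \<noteq> 0" for t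
    proof -
      let ?y = "x + t *\<^sub>R h"
      let ?D = "f ?y - f x - \<phi> (norm x) * ?d t"
      have "0 \<le> ?D" and D_le: "?D \<le> (\<phi> (norm ?y) - \<phi> (norm x)) * ?d t"
        using f_sub[of x ?y] f_sub[of ?y x] by (simp_all add: algebra_simps)
      note D_le
      also have "\<dots> \<le> \<bar>(\<phi> (norm ?y) - \<phi> (norm x)) * ?d t\<bar>" by (rule abs_ge_self)
      also have "\<dots> = \<bar>\<phi> (norm ?y) - \<phi> (norm x)\<bar> * \<bar>?d t\<bar>" by (rule abs_mult)
      also have "\<dots> \<le> \<bar>\<phi> (norm ?y) - \<phi> (norm x)\<bar> * (\<bar>t\<bar> * norm h)"
        using norm_triangle_ineq3[of ?y x] by (intro mult_left_mono) auto
      finally have "\<bar>?D\<bar> \<le> \<bar>\<phi> (norm ?y) - \<phi> (norm x)\<bar> * norm h * \<bar>t\<bar>"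
        using \<open>0 \<le> ?D\<close> by (simp add: mult_ac)
      then have "\<bar>?D\<bar> / \<bar>t\<bar> \<le> \<bar>\<phi> (norm ?y) - \<phi> (norm x)\<bar> * norm h"
        using that by (simp add: pos_divide_le_eq)
      moreover have "?e t = ?D / t" by (simp flip: diff_divide_distrib)
      ultimately show ?thesis by (simp add: abs_divide)
    qed
    then have "(?e \<longlongrightarrow> 0) (at 0)"
      by (intro Lim_null_comparison[OF _ zero]) (auto simp: eventually_at_filter)
    from tendsto_add[OF this main] show ?thesis by simp
  qed
  have G_strict: "z = x" if eq: "f z = f x + blinfun_apply (G x) (z - x)" for x z
  proof -
    \<comment> \<open>Different norms would make the one-variable inequality strict. With equal
      norms, \<open>N x\<close> attains the norm at both vectors.\<close>
    have norm_eq: "norm z = norm x"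
    proof (rule ccontr)
      assume "norm z \<noteq> norm x"
      then have "f x + \<phi> (norm x) * (norm z - norm x) < f z"
        unfolding f_def by (intro gauge_primitive_strict[OF \<phi>]) auto
      then show False using eq G_le[of x "z - x"] by simp
    qed
    show ?thesis
    proof (cases "x = 0")
      case False
      have "f z = f x" by (simp add: f_def norm_eq)
      then have "blinfun_apply (G x) z = blinfun_apply (G x) x"
        using eq by (simp add: blinfun.diff_right)
      moreover have "\<phi> (norm x) \<noteq> 0" using pos[of "norm x"] False by simp
      ultimately have "blinfun_apply (N x) z = norm x"
        using N_self[OF False] by (simp add: G_def blinfun.scaleR_left)
      then show ?thesis
        using strictly_convex_norming_eq[OF strict False norm_eq, of "N x"] N_self[OF False] N_norm[OF False]
        by simp
    qed (use norm_eq in simp)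
  qed
  have coercive: "\<exists>R. \<forall>x. R \<le> norm x \<longrightarrow> M * norm x \<le> f x" for M
  proof -
    obtain r where r: "0 \<le> r" "2 * \<bar>M\<bar> \<le> \<phi> r"
      using lim[unfolded filterlim_at_top, rule_format, of "2 * \<bar>M\<bar>"]
      by (metis eventually_at_top_linorder linear)
    \<comment> \<open>Beyond \<open>2 * r\<close> at least half of \<open>norm x\<close> lies above
      \<open>r\<close>; the factor 2 in the choice of \<open>r\<close> makes up for the other
      half.\<close>
    have "M * norm x \<le> f x" if x: "2 * r \<le> norm x" for x
    proof -
      have "M * norm x \<le> \<bar>M\<bar> * norm x" by (intro mult_right_mono) auto
      also have "\<dots> \<le> (2 * \<bar>M\<bar>) * (norm x - r)"
        using mult_left_mono[OF x, of "\<bar>M\<bar>"] by (simp add: algebra_simps)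
      also have "\<dots> \<le> \<phi> r * (norm x - r)" using r x by (intro mult_right_mono) auto
      also have "\<dots> \<le> integral {0..r} \<phi> + \<phi> r * (norm x - r)"
        using gauge_primitive_subgradient[OF \<phi>, of 0 r] r(1) by (simp add: \<phi>0)
      also have "\<dots> \<le> f x"
        unfolding f_def using r(1) by (intro gauge_primitive_subgradient[OF \<phi>]) auto
      finally show ?thesis .
    qed
    then show ?thesis by blast
  qed
  have bounded: "\<exists>B. \<forall>x. norm x \<le> r \<longrightarrow> f x \<le> B" for r
  proof (intro exI allI impI)
    fix x :: 'a assume x: "norm x \<le> r"
    then have r: "0 \<le> r" using norm_ge_zero[of x] by linarith
    have "0 \<le> \<phi> (norm x) * (r - norm x)" using nonneg x by simp
    then show "f x \<le> integral {0..r} \<phi>"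
      using gauge_primitive_subgradient[OF \<phi> norm_ge_zero[of x] r] by (simp add: f_def)
  qed
  interpret legendre_potential f G
    by unfold_locales (fact refl G_sub G_deriv G_strict coercive bounded)+
  \<comment> \<open>For such \<open>y\<close> the point \<open>x\<close> minimises \<open>f\<close>
    minus \<open>y\<close> on the whole space. \<open>inv G y\<close> solves the same variational
    inequality trivially, so the two points coincide.\<close>
  have "y = G x" if "y \<in> duality_map \<phi> x" for x y
  proof -
    have y: "blinfun_apply y x = norm x * \<phi> (norm x)" "norm y = \<phi> (norm x)"
      using that by (auto simp: duality_map_def)
    have "f x - blinfun_apply y x \<le> f z - blinfun_apply y z" for z
      using f_sub[of x z] norm_blinfun[of y z] y by (simp add: algebra_simps abs_le_iff)
    then have "0 \<le> blinfun_apply (y - G x) (x - z)" for z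
      using minimizer_iff_variational[of UNIV x y] by simp
    from this[of "inv G y"] show ?thesis
      using variational_unique[of y x "inv G y"] by simp
  qed
  moreover have "G x \<in> duality_map \<phi> x" for x
    by (simp add: duality_map_def G_self G_norm mult.commute)
  ultimately have "duality_map \<phi> x = {G x}" for x by blast
  moreover have "legendre_potential (\<lambda>x. integral {0..norm x} \<phi>) G"
    using legendre_potential_axioms by (simp add: f_def[abs_def])
  ultimately show ?thesis using that by blast
qed

theorem proposition3p17:
  fixes \<phi> :: "real \<Rightarrow> real" and K :: "'a::banach set"
  assumes "gauge_function \<phi>"
    and "reflexive_space TYPE('a)"
    and "strictly_convex_space TYPE('a)"
    and "gateaux_differentiable_space TYPE('a)"
    and "K \<noteq> {}"
  shows
    "(convex K \<and> closed K \<longrightarrow>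
        left_chebyshev (gauge_potential \<phi>) K \<and> left_pythagorean (gauge_potential \<phi>) K) \<and>
     (convex (\<Union>x\<in>K. duality_map \<phi> x) \<and> closed (\<Union>x\<in>K. duality_map \<phi> x) \<longrightarrow>
        right_chebyshev (gauge_potential \<phi>) K \<and> right_pythagorean (gauge_potential \<phi>) K) \<and>
     is_information_on (bregman (gauge_potential \<phi> :: 'a \<Rightarrow> ereal)) UNIV \<and>
     is_information_on (bregman (convex_conjugate (gauge_potential \<phi> :: 'a \<Rightarrow> ereal))) UNIV \<and>
     (convex K \<and> closed K \<longrightarrow>
        zone_consistent (gauge_potential \<phi>) (left_projection (gauge_potential \<phi>) K)) \<and>
     (convex (\<Union>x\<in>K. duality_map \<phi> x) \<and> closed (\<Union>x\<in>K. duality_map \<phi> x) \<longrightarrow>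
        zone_consistent (gauge_potential \<phi>) (right_projection (gauge_potential \<phi>) K))"
proof -
  obtain G :: "'a \<Rightarrow> ('a \<Rightarrow>\<^sub>L real)"
    where G: "legendre_potential (\<lambda>x. integral {0..norm x} \<phi>) G"
      and duality: "\<And>x. duality_map \<phi> x = {G x}"
    using legendre_potential_gauge[OF assms(1-4)] by metis
  interpret legendre_potential "\<lambda>x::'a. integral {0..norm x} \<phi>" G by (rule G)
  have potential: "gauge_potential \<phi> = \<Psi>" by (auto simp: gauge_potential_def)
  have image: "(\<Union>x\<in>K. duality_map \<phi> x) = G ` K" by (auto simp: duality)
  have "is_information_on (bregman (convex_conjugate \<Psi>)) UNIV"
    unfolding convex_conjugate_eq
    by (rule legendre_potential.information[OF legendre_potential_conjugate])
  then show ?thesis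
    unfolding potential image
    using left_chebyshev_pythagorean right_chebyshev_pythagorean information zone_consistent_trivial assms(5)
    by blast
qed

end
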